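(* Let $k\geq 2$ be an integer and let $\Omega\subset\mathbb{R}^2$ be a $k$-rotationally symmetric planar convex body. Then $\Omega$ is Cheeger-regular, that is, for every choice of dots $x_1,\dots,x_k$ of $\Omega$, with associated edges $L_1,\dots,L_k$, the Cheeger set $C_\Omega$ of $\Omega$ touches all the edges of $\Omega$: $C_\Omega\cap L_i\neq\emptyset$ for all $i=1,\dots,k$.
   Context: A planar convex body is a compact convex subset of $\mathbb{R}^2$ with nonempty interior. $d$ denotes the Euclidean distance in the plane. Rotational symmetry. For an integer $k\geq 2$, a planar convex body $\Omega$ is $k$-rotationally symmetric if there exists a point $p\in\Omega$ (the center of symmetry) such that $\Omega$ is invariant under the rotation $\theta_k$ of angle $2\pi/k$ centered at $p$. Dots and edges. Let $\Omega$ be a $k$-rotationally symmetric planar convex body with center of symmetry $p$, and let $R>0$ be its circumradius (the radius of the smallest disk containing $\Omega$). There exist points of $\partial\Omega$ at distance $R$ from $p$. A set of dots of $\Omega$ is a choice of $k$ points $x_1,\dots,x_k\in\partial\Omega$ with $d(x_i,p)=R$ for all $i$ that is $k$-rotationally symmetric, i.e. labelled counterclockwise along $\partial\Omega$ so that $x_{i+1}=\theta_k(x_i)$, with the convention $x_{k+1}=x_1$. (The set of dots need not be unique.) Given dots $x_1,\dots,x_k$, the edges of $\Omega$ are the $k$ closed pieces $L_i=[x_i,x_{i+1}]$ of $\partial\Omega$, $i=1,\dots,k$, where $L_i$ is the arc of $\partial\Omega$ going counterclockwise from $x_i$ to $x_{i+1}$, endpoints included. Cheeger set. For a bounded measurable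 set $X\subset\mathbb{R}^2$, $P(X)$ denotes the perimeter of $X$ (the one-dimensional Hausdorff measure of $\partial X$) and $A(X)$ its area. The Cheeger constant of a planar convex body $\Omega$ is $h(\Omega)=\inf P(X)/A(X)$, the infimum being over all measurable sets $X\subseteq\Omega$ with $A(X)>0$. A Cheeger set of $\Omega$ is a set $X\subseteq\Omega$ attaining this infimum. It is known that for a planar convex body a Cheeger set exists and is unique (up to sets of zero area) and convex; $C_\Omega$ denotes its closed representative, i.e. the unique closed convex set $C_\Omega\subseteq\Omega$ with positive area and $P(C_\Omega)/A(C_\Omega)=h(\Omega)$. *)

theory Defs
  imports "HOL-Complex_Analysis.Winding_Numbers"
begin

text \<open>The plane is \<^typ>\<open>complex\<close>, with \<^const>\<open>dist\<close> as Euclidean distance and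
  \<^term>\<open>lebesgue\<close> as planar Lebesgue measure.\<close>

definition planar_convex_body :: "complex set \<Rightarrow> bool" where
  "planar_convex_body \<Omega> \<longleftrightarrow> compact \<Omega> \<and> convex \<Omega> \<and> interior \<Omega> \<noteq> {}"

definition rotation :: "nat \<Rightarrow> complex \<Rightarrow> complex \<Rightarrow> complex" where
  "rotation k p z = p + cis (2 * pi / real k) * (z - p)"

definition symmetry_center :: "nat \<Rightarrow> complex set \<Rightarrow> complex \<Rightarrow> bool" where
  "symmetry_center k \<Omega> p \<longleftrightarrow> p \<in> \<Omega> \<and> rotation k p ` \<Omega> = \<Omega>"

definition rotationally_symmetric :: "nat \<Rightarrow> complex set \<Rightarrow> bool" where
  "rotationally_symmetric k \<Omega> \<longleftrightarrow> (\<exists>p. symmetry_center k \<Omega> p)"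

definition circumradius :: "complex set \<Rightarrow> real" where
  "circumradius \<Omega> = Inf {r. 0 \<le> r \<and> (\<exists>c. \<Omega> \<subseteq> cball c r)}"

text \<open>Dots are indexed by \<open>1, \<dots>, k + 1\<close>, the last index repeating the first; values of \<open>x\<close>
  outside this range are irrelevant.\<close>

definition dots :: "nat \<Rightarrow> complex set \<Rightarrow> complex \<Rightarrow> (nat \<Rightarrow> complex) \<Rightarrow> bool" where
  "dots k \<Omega> p x \<longleftrightarrow>
     (\<forall>i\<in>{1..k}. x i \<in> frontier \<Omega> \<and> dist (x i) p = circumradius \<Omega> \<and>
                 x (i + 1) = rotation k p (x i)) \<and>
     x (k + 1) = x 1"

definition ccw_boundary_path :: "complex set \<Rightarrow> (real \<Rightarrow> complex) \<Rightarrow> bool" where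
  "ccw_boundary_path \<Omega> g \<longleftrightarrow>
     simple_path g \<and> pathfinish g = pathstart g \<and> path_image g = frontier \<Omega> \<and>
     (\<forall>w\<in>interior \<Omega>. winding_number g w = 1)"

text \<open>The closed boundary arc traversed counterclockwise from \<open>a\<close> to \<open>b\<close>. For a convex body and
  distinct boundary points \<open>a\<close>, \<open>b\<close> it does not depend on the parametrization \<open>g\<close>.\<close>

definition ccw_arc :: "complex set \<Rightarrow> complex \<Rightarrow> complex \<Rightarrow> complex set" where
  "ccw_arc \<Omega> a b =
     {z. \<exists>g t. ccw_boundary_path \<Omega> g \<and> pathstart g = a \<and> t \<in> {0..1} \<and> g t = b \<and> z \<in> g ` {0..t}}"

definition edge :: "complex set \<Rightarrow> (nat \<Rightarrow> complex) \<Rightarrow> nat \<Rightarrow> complex set" where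
  "edge \<Omega> x i = ccw_arc \<Omega> (x i) (x (i + 1))"

text \<open>One-dimensional Hausdorff (outer) measure. Covering sets are required to be bounded because
  \<^const>\<open>diameter\<close> is meaningful only for bounded sets; they may be empty (diameter 0).\<close>

definition hausdorff1_delta :: "real \<Rightarrow> 'a::metric_space set \<Rightarrow> ennreal" where
  "hausdorff1_delta \<delta> S =
     (INF U\<in>{U :: nat \<Rightarrow> 'a set. (\<forall>n. bounded (U n) \<and> diameter (U n) \<le> \<delta>) \<and> S \<subseteq> (\<Union>n. U n)}.
        \<Sum>n. ennreal (diameter (U n)))"

definition hausdorff1 :: "'a::metric_space set \<Rightarrow> ennreal" where
  "hausdorff1 S = (SUP \<delta>\<in>{0<..}. hausdorff1_delta \<delta> S)"

definition perimeter :: "complex set \<Rightarrow> ennreal" where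
  "perimeter X = hausdorff1 (frontier X)"

definition area :: "complex set \<Rightarrow> ennreal" where
  "area X = emeasure lebesgue X"

definition cheeger_constant :: "complex set \<Rightarrow> ennreal" where
  "cheeger_constant \<Omega> =
     (INF X\<in>{X. X \<in> sets lebesgue \<and> X \<subseteq> \<Omega> \<and> area X > 0}. perimeter X / area X)"

definition is_cheeger_set :: "complex set \<Rightarrow> complex set \<Rightarrow> bool" where
  "is_cheeger_set \<Omega> X \<longleftrightarrow>
     X \<in> sets lebesgue \<and> X \<subseteq> \<Omega> \<and> area X > 0 \<and> perimeter X / area X = cheeger_constant \<Omega>"

text \<open>The closed convex Cheeger set of a planar convex body exists and is unique. It is described
  here by its defining property, without building in its uniqueness.\<close>

definition is_closed_cheeger_set :: "complex set \<Rightarrow> complex set \<Rightarrow> bool" where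
  "is_closed_cheeger_set \<Omega> C \<longleftrightarrow> closed C \<and> convex C \<and> is_cheeger_set \<Omega> C"

definition cheeger_regular :: "nat \<Rightarrow> complex set \<Rightarrow> bool" where
  "cheeger_regular k \<Omega> \<longleftrightarrow>
     (\<forall>p x C. symmetry_center k \<Omega> p \<longrightarrow> dots k \<Omega> p x \<longrightarrow> is_closed_cheeger_set \<Omega> C \<longrightarrow>
        (\<forall>i\<in>{1..k}. C \<inter> edge \<Omega> x i \<noteq> {}))"

end

theory Submission
  imports Defs
begin

text \<open>
  Why every rotationally symmetric planar convex body is Cheeger-regular. Let \<open>p\<close> be the centre, \<open>\<theta>\<close>
  the rotation about \<open>p\<close> by \<open>2\<pi>/k\<close>, and \<open>C\<close> a closed convex Cheeger set of \<open>\<Omega>\<close>. The idea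
  is to symmetrize \<open>C\<close> without leaving the class of optimal sets, by passing to the Minkowski average
  \<open>M = (C + \<theta> C + \<dots> + \<theta>\<^sup>k\<^sup>-\<^sup>1 C) / k\<close>, which lies in \<open>\<Omega>\<close> by convexity and symmetry.

  \<^item> Perimeter is convex under Minkowski combination (\<open>perimeter_minkowski_mix_le\<close>) and area does not drop
    below the smaller of the two areas (\<open>area_minkowski_mix_ge\<close>, a form of Brunn--Minkowski). All rotated
    copies of \<open>C\<close> have the same perimeter and area, so \<open>M\<close> is at least as good as \<open>C\<close>.
  \<^item> If \<open>M\<close> missed \<open>\<partial>\<Omega>\<close>, it could be enlarged by a homothety inside \<open>\<Omega>\<close>, which strictly lowers the
    ratio of perimeter to area. So \<open>M\<close> contains a point \<open>m\<close> of \<open>\<partial>\<Omega>\<close>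
    (\<open>optimal_body_meets_frontier\<close>).
  \<^item> Write \<open>m\<close> as an average of points \<open>q\<^sub>j \<in> \<theta>\<^sup>j C\<close>. All \<open>q\<^sub>j\<close> lie on the supporting line at
    \<open>m\<close>. The dots are points of \<open>\<Omega>\<close> farthest from \<open>p\<close>, so a segment of \<open>\<partial>\<Omega>\<close> cannot cross the ray
    through a dot (\<open>face_in_sector\<close>): all \<open>q\<^sub>j\<close> lie on one and the same edge. Rotating \<open>q\<^sub>j\<close> back
    by \<open>\<theta>\<^sup>j\<close> gives a point of \<open>C\<close> on each of the \<open>k\<close> edges.

  Perimeter here is the Hausdorff measure of the topological boundary, so its convexity is proved from the
  definition. For \<open>n\<close> equally spaced unit vectors \<open>e\<^sub>j\<close> and the support function \<open>h\<^sub>K\<close>,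
  \<open>2 sin(\<pi>/n) \<Sum> h\<^sub>K(e\<^sub>j) \<le> perimeter K \<le> 2 tan(\<pi>/n) \<Sum> h\<^sub>K(e\<^sub>j)\<close>: the upper bound is the
  perimeter of the circumscribed equiangular polygon, the lower bound does not exceed the
  perimeter of an inscribed polygon through the points of contact. The support function of a Minkowski combination is the combination of the
  support functions, and the two bounds agree in the limit.
\<close>

section \<open>One-dimensional Hausdorff measure\<close>

lemma hausdorff1_delta_le:
  assumes "\<And>n. bounded (U n)" "\<And>n. diameter (U n) \<le> \<delta>" "S \<subseteq> (\<Union>n. U n)"
  shows "hausdorff1_delta \<delta> S \<le> (\<Sum>n. ennreal (diameter (U n)))"
  unfolding hausdorff1_delta_def by (rule INF_lower) (use assms in auto)

lemma hausdorff1_delta_antimono: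
  assumes "\<delta> \<le> \<epsilon>" shows "hausdorff1_delta \<epsilon> S \<le> hausdorff1_delta \<delta> S"
  unfolding hausdorff1_delta_def by (rule INF_superset_mono) (use assms in \<open>auto intro: order_trans\<close>)

lemma hausdorff1_delta_le_hausdorff1: "0 < \<delta> \<Longrightarrow> hausdorff1_delta \<delta> S \<le> hausdorff1 S"
  unfolding hausdorff1_def by (rule SUP_upper) auto

lemma hausdorff1_mono:
  assumes "S \<subseteq> T" shows "hausdorff1 S \<le> hausdorff1 T"
  unfolding hausdorff1_def hausdorff1_delta_def
  by (intro SUP_mono' INF_superset_mono) (use assms in auto)

lemma diameter_lipschitz_image_le:
  fixes f :: "'a::metric_space \<Rightarrow> 'b::metric_space"
  assumes lip: "\<And>x y. x \<in> S \<Longrightarrow> y \<in> S \<Longrightarrow> dist (f x) (f y) \<le> c * dist x y"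
    and "0 \<le> c" "bounded U"
  shows "diameter (f ` (U \<inter> S)) \<le> c * diameter U" and "bounded (f ` (U \<inter> S))"
proof -
  have le: "dist (f x) (f y) \<le> c * diameter U" if "x \<in> U \<inter> S" "y \<in> U \<inter> S" for x y
  proof -
    have "dist (f x) (f y) \<le> c * dist x y" using lip that by auto
    also have "\<dots> \<le> c * diameter U"
      using diameter_bounded_bound[OF \<open>bounded U\<close>] that \<open>0 \<le> c\<close> by (intro mult_left_mono) auto
    finally show ?thesis .
  qed
  show "diameter (f ` (U \<inter> S)) \<le> c * diameter U"
  proof (cases "U \<inter> S = {}")
    case True
    then show ?thesis using diameter_ge_0[OF \<open>bounded U\<close>] \<open>0 \<le> c\<close> by simp
  next
    case False
    have "f ` (U \<inter> S) \<noteq> {}" using False by auto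
    then show ?thesis using le unfolding diameter_def[of "f ` (U \<inter> S)"]
      by (auto intro!: cSUP_least simp del: UnCI)
  qed
  show "bounded (f ` (U \<inter> S))"
    unfolding bounded_two_points using le by blast
qed

lemma hausdorff1_lipschitz_image_le:
  fixes f :: "'a::metric_space \<Rightarrow> 'b::metric_space"
  assumes lip: "\<And>x y. x \<in> S \<Longrightarrow> y \<in> S \<Longrightarrow> dist (f x) (f y) \<le> c * dist x y" and "0 < c"
  shows "hausdorff1 (f ` S) \<le> ennreal c * hausdorff1 S"
  unfolding hausdorff1_def[of "f ` S"]
proof (rule SUP_least)
  fix \<delta> :: real assume "\<delta> \<in> {0<..}"
  then have d: "0 < \<delta>" "0 < \<delta> / c" using \<open>0 < c\<close> by auto
  have "hausdorff1_delta \<delta> (f ` S) \<le> ennreal c * (\<Sum>n. ennreal (diameter (U n)))"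
    if U: "\<And>n. bounded (U n)" "\<And>n. diameter (U n) \<le> \<delta> / c" "S \<subseteq> (\<Union>n. U n)" for U
  proof -
    have "hausdorff1_delta \<delta> (f ` S) \<le> (\<Sum>n. ennreal (diameter (f ` (U n \<inter> S))))"
    proof (rule hausdorff1_delta_le)
      fix n
      show "bounded (f ` (U n \<inter> S))"
        using diameter_lipschitz_image_le(2)[OF lip _ U(1)] \<open>0 < c\<close> by auto
      have "diameter (f ` (U n \<inter> S)) \<le> c * diameter (U n)"
        using diameter_lipschitz_image_le(1)[OF lip _ U(1)] \<open>0 < c\<close> by auto
      also have "\<dots> \<le> c * (\<delta> / c)" using U(2) \<open>0 < c\<close> by (intro mult_left_mono) auto
      finally show "diameter (f ` (U n \<inter> S)) \<le> \<delta>" using \<open>0 < c\<close> by simp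
    qed (use U(3) in blast)
    also have "\<dots> \<le> (\<Sum>n. ennreal c * ennreal (diameter (U n)))"
    proof (intro suminf_le summableI)
      fix n
      have "diameter (f ` (U n \<inter> S)) \<le> c * diameter (U n)"
        using diameter_lipschitz_image_le(1)[OF lip _ U(1)] \<open>0 < c\<close> by auto
      then show "ennreal (diameter (f ` (U n \<inter> S))) \<le> ennreal c * ennreal (diameter (U n))"
        using \<open>0 < c\<close> by (simp add: ennreal_mult'[symmetric] ennreal_leI)
    qed
    finally show ?thesis by simp
  qed
  then have "inverse (ennreal c) * hausdorff1_delta \<delta> (f ` S) \<le> hausdorff1_delta (\<delta> / c) S"
    unfolding hausdorff1_delta_def[of "\<delta> / c"]
  proof (intro INF_greatest, goal_cases)
    case (1 U)
    then have "inverse (ennreal c) * hausdorff1_delta \<delta> (f ` S)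
        \<le> inverse (ennreal c) * (ennreal c * (\<Sum>n. ennreal (diameter (U n))))"
      by (intro mult_left_mono) auto
    also have "\<dots> = (\<Sum>n. ennreal (diameter (U n)))"
      using \<open>0 < c\<close> by (simp add: mult.assoc[symmetric] inverse_ennreal ennreal_mult[symmetric])
    finally show ?case .
  qed
  also have "\<dots> \<le> hausdorff1 S" using d by (intro hausdorff1_delta_le_hausdorff1)
  finally have "ennreal c * (inverse (ennreal c) * hausdorff1_delta \<delta> (f ` S)) \<le> ennreal c * hausdorff1 S"
    by (rule mult_left_mono) simp
  then show "hausdorff1_delta \<delta> (f ` S) \<le> ennreal c * hausdorff1 S"
    using \<open>0 < c\<close> by (simp add: mult.assoc[symmetric] inverse_ennreal ennreal_mult[symmetric])
qed

lemma suminf_ennreal_even_odd: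
  fixes f :: "nat \<Rightarrow> ennreal"
  shows "(\<Sum>n. f n) = (\<Sum>n. f (2 * n)) + (\<Sum>n. f (2 * n + 1))"
proof -
  have "(\<lambda>n. sum f {n * 2 ..< n * 2 + 2}) sums (\<Sum>n. f n)"
    by (rule sums_group) (auto intro: summable_sums)
  also have "(\<lambda>n. sum f {n * 2 ..< n * 2 + 2}) = (\<lambda>n. f (2 * n) + f (2 * n + 1))"
    by (auto simp: mult.commute numeral_2_eq_2)
  finally have "(\<Sum>n. f n) = (\<Sum>n. f (2 * n) + f (2 * n + 1))" by (simp add: sums_iff)
  then show ?thesis by (simp add: suminf_add)
qed

text \<open>Adding two infima over independent index sets: the covers of the two sets are chosen independently.\<close>

lemma ennreal_le_INF_add_INF:
  fixes f :: "'a \<Rightarrow> ennreal" and g :: "'b \<Rightarrow> ennreal"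
  assumes le: "\<And>u v. u \<in> A \<Longrightarrow> v \<in> B \<Longrightarrow> x \<le> f u + g v"
  shows "x \<le> (INF u\<in>A. f u) + (INF v\<in>B. g v)"
proof (rule ennreal_le_epsilon)
  fix e :: real assume fin: "(INF u\<in>A. f u) + (INF v\<in>B. g v) < top" and e: "0 < e"
  have fin: "(INF u\<in>A. f u) \<noteq> \<infinity>" "(INF v\<in>B. g v) \<noteq> \<infinity>"
    using fin ennreal_add_eq_top[of "INF u\<in>A. f u" "INF v\<in>B. g v"]
    unfolding infinity_ennreal_def less_top[symmetric] by blast+
  obtain u where u: "u \<in> A" "f u < (INF u\<in>A. f u) + ennreal (e/2)"
    using INF_approx_ennreal[of "e/2", OF half_gt_zero[OF e] refl fin(1)] by blast
  obtain v where v: "v \<in> B" "g v < (INF v\<in>B. g v) + ennreal (e/2)"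
    using INF_approx_ennreal[of "e/2", OF half_gt_zero[OF e] refl fin(2)] by blast
  have "x \<le> f u + g v" using le u v by blast
  also have "\<dots> \<le> ((INF u\<in>A. f u) + ennreal (e/2)) + ((INF v\<in>B. g v) + ennreal (e/2))"
    using u v by (intro add_mono) auto
  also have "\<dots> = (INF u\<in>A. f u) + (INF v\<in>B. g v) + (ennreal (e/2) + ennreal (e/2))"
    by (simp only: ac_simps)
  also have "ennreal (e/2) + ennreal (e/2) = ennreal e"
    using e by (simp flip: ennreal_plus)
  finally show "x \<le> (INF u\<in>A. f u) + (INF v\<in>B. g v) + ennreal e" .
qed

lemma hausdorff1_Un_le: "hausdorff1 (S \<union> T) \<le> hausdorff1 S + hausdorff1 T"
  unfolding hausdorff1_def[of "S \<union> T"]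
proof (rule SUP_least)
  fix \<delta> :: real assume d: "\<delta> \<in> {0<..}"
  have le: "hausdorff1_delta \<delta> (S \<union> T)
      \<le> (\<Sum>n. ennreal (diameter (U n))) + (\<Sum>n. ennreal (diameter (V n)))"
    if U: "\<And>n. bounded (U n)" "\<And>n. diameter (U n) \<le> \<delta>" "S \<subseteq> (\<Union>n. U n)"
      and V: "\<And>n. bounded (V n)" "\<And>n. diameter (V n) \<le> \<delta>" "T \<subseteq> (\<Union>n. V n)" for U V
  proof -
    define W where "W n = (if even n then U (n div 2) else V (n div 2))" for n
    have W: "W (2 * n) = U n" "W (2 * n + 1) = V n" for n by (auto simp: W_def)
    have "S \<union> T \<subseteq> (\<Union>n. W n)"
    proof
      fix z assume "z \<in> S \<union> T"
      then obtain n where "z \<in> U n \<or> z \<in> V n" using U V by blast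
      then show "z \<in> (\<Union>n. W n)" using W[of n] by blast
    qed
    then have "hausdorff1_delta \<delta> (S \<union> T) \<le> (\<Sum>n. ennreal (diameter (W n)))"
      using U V by (intro hausdorff1_delta_le) (auto simp: W_def)
    also have "\<dots> = (\<Sum>n. ennreal (diameter (U n))) + (\<Sum>n. ennreal (diameter (V n)))"
      by (subst suminf_ennreal_even_odd) (simp only: W)
    finally show ?thesis .
  qed
  have "hausdorff1_delta \<delta> (S \<union> T) \<le> hausdorff1_delta \<delta> S + hausdorff1_delta \<delta> T"
    unfolding hausdorff1_delta_def[of \<delta> S] hausdorff1_delta_def[of \<delta> T]
    by (rule ennreal_le_INF_add_INF) (use le in auto)
  also have "\<dots> \<le> hausdorff1 S + hausdorff1 T"
    using d by (intro add_mono hausdorff1_delta_le_hausdorff1) auto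
  finally show "hausdorff1_delta \<delta> (S \<union> T) \<le> hausdorff1 S + hausdorff1 T" .
qed

lemma hausdorff1_empty [simp]: "hausdorff1 {} = 0"
proof -
  have "hausdorff1_delta \<delta> {} \<le> 0" if "\<delta> > 0" for \<delta>
    using hausdorff1_delta_le[of "\<lambda>_. {}" \<delta> "{}"] that by simp
  then show ?thesis unfolding hausdorff1_def by (intro antisym SUP_least) auto
qed

lemma hausdorff1_UN_le:
  assumes "finite I" shows "hausdorff1 (\<Union>i\<in>I. S i) \<le> (\<Sum>i\<in>I. hausdorff1 (S i))"
  using assms
proof induction
  case (insert i I)
  have "hausdorff1 (\<Union>j\<in>insert i I. S j) \<le> hausdorff1 (S i) + hausdorff1 (\<Union>j\<in>I. S j)"
    using hausdorff1_Un_le[of "S i" "\<Union>j\<in>I. S j"] by simp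
  also have "\<dots> \<le> hausdorff1 (S i) + (\<Sum>j\<in>I. hausdorff1 (S j))"
    using insert by (intro add_left_mono) auto
  finally show ?case using insert by simp
qed simp

text \<open>A cover by sets of diameter below the gap between \<open>S\<close> and \<open>T\<close> splits into a cover of \<open>S\<close> and
  one of \<open>T\<close>, so the outer measure is additive here. Disjoint compact pieces always have such a gap.\<close>

lemma hausdorff1_Un_separated:
  fixes S T :: "'a::metric_space set"
  assumes "0 < d" and sep: "\<And>x y. x \<in> S \<Longrightarrow> y \<in> T \<Longrightarrow> d \<le> dist x y"
  shows "hausdorff1 S + hausdorff1 T \<le> hausdorff1 (S \<union> T)"
proof -
  have le: "hausdorff1_delta \<delta> S + hausdorff1_delta \<delta> T \<le> hausdorff1_delta \<delta> (S \<union> T)"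
    if d: "\<delta> < d" for \<delta>
    unfolding hausdorff1_delta_def[of \<delta> "S \<union> T"]
  proof (rule INF_greatest)
    fix U :: "nat \<Rightarrow> 'a set"
    assume "U \<in> {U. (\<forall>n. bounded (U n) \<and> diameter (U n) \<le> \<delta>) \<and> S \<union> T \<subseteq> (\<Union>n. U n)}"
    then have U: "bounded (U n)" "diameter (U n) \<le> \<delta>" "S \<union> T \<subseteq> (\<Union>n. U n)" for n by auto
    have sub: "diameter (U n \<inter> X) \<le> diameter (U n)" for n X
      using U by (intro diameter_subset) auto
    have "hausdorff1_delta \<delta> S + hausdorff1_delta \<delta> T
        \<le> (\<Sum>n. ennreal (diameter (U n \<inter> S))) + (\<Sum>n. ennreal (diameter (U n \<inter> T)))"
      using U sub by (intro add_mono hausdorff1_delta_le) (auto intro: bounded_subset order_trans[OF sub])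
    also have "\<dots> = (\<Sum>n. ennreal (diameter (U n \<inter> S)) + ennreal (diameter (U n \<inter> T)))"
      by (simp add: suminf_add)
    also have "\<dots> \<le> (\<Sum>n. ennreal (diameter (U n)))"
    proof (intro suminf_le summableI)
      fix n
      have "U n \<inter> S = {} \<or> U n \<inter> T = {}"
      proof (rule ccontr)
        assume "\<not> ?thesis"
        then obtain x y where xy: "x \<in> U n" "x \<in> S" "y \<in> U n" "y \<in> T" by auto
        then have "d \<le> diameter (U n)"
          using sep[of x y] diameter_bounded_bound[OF U(1), of x n y] by auto
        with U(2)[of n] d show False by simp
      qed
      then show "ennreal (diameter (U n \<inter> S)) + ennreal (diameter (U n \<inter> T)) \<le> ennreal (diameter (U n))"
        using sub[of n S] sub[of n T] by (auto intro: ennreal_leI)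
    qed
    finally show "hausdorff1_delta \<delta> S + hausdorff1_delta \<delta> T \<le> (\<Sum>n. ennreal (diameter (U n)))" .
  qed
  have both: "hausdorff1_delta \<delta> S + hausdorff1_delta \<epsilon> T \<le> hausdorff1 (S \<union> T)" if "0 < \<delta>" "0 < \<epsilon>" for \<delta> \<epsilon>
  proof -
    define m where "m = min (d / 2) (min \<delta> \<epsilon>)"
    have m: "0 < m" "m < d" "m \<le> \<delta>" "m \<le> \<epsilon>" using that assms(1) by (auto simp: m_def)
    have "hausdorff1_delta \<delta> S + hausdorff1_delta \<epsilon> T \<le> hausdorff1_delta m S + hausdorff1_delta m T"
      using m by (intro add_mono hausdorff1_delta_antimono)
    also have "\<dots> \<le> hausdorff1 (S \<union> T)"
      using le[of m] hausdorff1_delta_le_hausdorff1[of m "S \<union> T"] m by (auto intro: order_trans)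
    finally show ?thesis .
  qed
  have "hausdorff1_delta \<delta> S + hausdorff1 T \<le> hausdorff1 (S \<union> T)" if "0 < \<delta>" for \<delta>
    unfolding hausdorff1_def[of T]
    by (subst ennreal_SUP_add_right[OF greaterThan_non_empty]) (use both that in \<open>auto intro!: SUP_least\<close>)
  then show ?thesis
    unfolding hausdorff1_def[of S]
    by (subst ennreal_SUP_add_left[OF greaterThan_non_empty, symmetric]) (auto intro!: SUP_least)
qed

lemma hausdorff1_disjoint_compact_UN:
  fixes S :: "'i \<Rightarrow> 'a::heine_borel set"
  assumes "finite I" "\<And>i. i \<in> I \<Longrightarrow> compact (S i)" "disjoint_family_on S I"
  shows "(\<Sum>i\<in>I. hausdorff1 (S i)) \<le> hausdorff1 (\<Union>i\<in>I. S i)"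
  using assms
proof induction
  case (insert i I)
  have disj: "S i \<inter> (\<Union>j\<in>I. S j) = {}"
    using insert.prems(2) insert.hyps(2) by (fastforce simp: disjoint_family_on_def)
  have "compact (S i)" "closed (\<Union>j\<in>I. S j)"
    using insert by (auto intro!: compact_imp_closed compact_UN)
  from separate_compact_closed[OF this disj] obtain d where d: "0 < d"
    "\<And>x y. x \<in> S i \<Longrightarrow> y \<in> (\<Union>j\<in>I. S j) \<Longrightarrow> d \<le> dist x y" by blast
  have "(\<Sum>j\<in>insert i I. hausdorff1 (S j)) \<le> hausdorff1 (S i) + hausdorff1 (\<Union>j\<in>I. S j)"
    using insert by (auto simp: disjoint_family_on_def intro!: add_left_mono)
  also have "\<dots> \<le> hausdorff1 (S i \<union> (\<Union>j\<in>I. S j))" using d by (rule hausdorff1_Un_separated)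
  finally show ?case by simp
qed simp

text \<open>Orthogonal projection onto the line through \<open>x\<close> and \<open>y\<close> does not increase diameters, and the
  projection of a connected set containing both points covers the whole segment between them. So every cover
  has total diameter at least the Lebesgue measure of that segment.\<close>

lemma dist_le_hausdorff1_connected:
  fixes x y :: "'a::euclidean_space"
  assumes "connected S" "x \<in> S" "y \<in> S"
  shows "ennreal (dist x y) \<le> hausdorff1 S"
proof (cases "x = y")
  case False
  define u where "u = sgn (y - x)"
  have nu: "norm u = 1" using False by (simp add: u_def norm_sgn)
  define f where "f z = (z - x) \<bullet> u" for z
  have fx: "f x = 0" by (simp add: f_def)
  have fy: "f y = dist x y"
    by (simp add: f_def u_def sgn_div_norm inner_commute dist_norm norm_minus_commute
        flip: power2_norm_eq_inner) (simp add: power2_eq_square inverse_eq_divide)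
  have flip: "\<bar>f a - f b\<bar> \<le> dist a b" for a b
  proof -
    have "f a - f b = (a - b) \<bullet> u" by (simp add: f_def inner_diff_left)
    then show ?thesis using Cauchy_Schwarz_ineq2[of "a - b" u] nu by (simp add: dist_norm)
  qed
  have "connected (f ` S)"
    unfolding f_def by (intro connected_continuous_image assms continuous_intros)
  then have seg: "{0..dist x y} \<subseteq> f ` S"
    using connected_contains_Icc[of "f ` S" "f x" "f y"] imageI[OF assms(2), of f] imageI[OF assms(3), of f]
    unfolding fx fy by blast
  have "ennreal (dist x y) \<le> hausdorff1_delta 1 S"
    unfolding hausdorff1_delta_def
  proof (rule INF_greatest)
    fix U :: "nat \<Rightarrow> 'a set"
    assume "U \<in> {U. (\<forall>n. bounded (U n) \<and> diameter (U n) \<le> 1) \<and> S \<subseteq> (\<Union>n. U n)}"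
    then have U: "bounded (U n)" "S \<subseteq> (\<Union>n. U n)" for n by auto
    \<comment> \<open>Each \<open>f ` U n\<close> lies in a compact interval whose length is at most the diameter of \<open>U n\<close>.\<close>
    have "\<exists>a. f ` U n \<subseteq> {a..a + diameter (U n)}" for n
    proof (cases "U n = {}")
      case False
      define a where "a = Inf (f ` U n)"
      have "dist (f v) (f w) \<le> diameter (U n)" if "v \<in> U n" "w \<in> U n" for v w
        using diameter_bounded_bound[OF U(1) that] flip[of v w] by (simp add: dist_real_def)
      then have bf: "bounded (f ` U n)" unfolding bounded_two_points by blast
      have "a \<le> f z \<and> f z \<le> a + diameter (U n)" if "z \<in> U n" for z
      proof
        show "a \<le> f z" unfolding a_def
          by (intro cINF_lower bounded_imp_bdd_below bf that)
        have "f z - diameter (U n) \<le> f w" if "w \<in> U n" for w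
          using diameter_bounded_bound[OF U(1) \<open>z \<in> U n\<close> that] flip[of z w] by linarith
        then have "f z - diameter (U n) \<le> a" unfolding a_def
          using False by (intro cINF_greatest)
        then show "f z \<le> a + diameter (U n)" by simp
      qed
      then show ?thesis by (intro exI[of _ a] image_subsetI) simp
    qed auto
    then obtain a where a: "\<And>n. f ` U n \<subseteq> {a n..a n + diameter (U n)}" by metis
    have "ennreal (dist x y) = emeasure lborel {0..dist x y}" by simp
    also have "\<dots> \<le> emeasure lborel (\<Union>n. {a n..a n + diameter (U n)})"
    proof (intro emeasure_mono)
      have "{0..dist x y} \<subseteq> f ` (\<Union>n. U n)" by (rule order_trans[OF seg image_mono[OF U(2)]])
      also have "\<dots> = (\<Union>n. f ` U n)" by (rule image_UN)
      also have "\<dots> \<subseteq> (\<Union>n. {a n..a n + diameter (U n)})" by (intro UN_mono subset_refl a)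
      finally show "{0..dist x y} \<subseteq> (\<Union>n. {a n..a n + diameter (U n)})" .
    qed auto
    also have "\<dots> \<le> (\<Sum>n. emeasure lborel {a n..a n + diameter (U n)})"
      by (intro emeasure_subadditive_countably) auto
    also have "\<dots> = (\<Sum>n. ennreal (diameter (U n)))" using diameter_ge_0[OF U(1)] by simp
    finally show "ennreal (dist x y) \<le> (\<Sum>n. ennreal (diameter (U n)))" .
  qed
  also have "\<dots> \<le> hausdorff1 S" by (rule hausdorff1_delta_le_hausdorff1) simp
  finally show ?thesis .
qed simp

text \<open>Cut the interval into \<open>N\<close> equal pieces of length at most \<open>\<delta>\<close>.\<close>

lemma hausdorff1_Icc_le:
  fixes a b :: real assumes "a \<le> b" shows "hausdorff1 {a..b} \<le> ennreal (b - a)"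
  unfolding hausdorff1_def
proof (rule SUP_least)
  fix \<delta> :: real assume "\<delta> \<in> {0<..}"
  then obtain N :: nat where N: "(b - a) / \<delta> < real N" using reals_Archimedean2 by blast
  moreover have "0 \<le> (b - a) / \<delta>" using assms \<open>\<delta> \<in> {0<..}\<close> by simp
  ultimately have N0: "0 < N" using of_nat_0_less_iff[where 'a=real, of N] by linarith
  define w where "w = (b - a) / real N"
  have w: "0 \<le> w" "w \<le> \<delta>" "real N * w = b - a"
    using assms N N0 \<open>\<delta> \<in> {0<..}\<close> by (auto simp: w_def field_simps)
  define U where "U n = (if n < N then {a + real n * w .. a + real (Suc n) * w} else {})" for n
  have dU: "diameter (U n) = (if n < N then w else 0)" for n
    using w by (simp add: U_def algebra_simps)
  have "{a..b} \<subseteq> (\<Union>n. U n)"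
  proof
    fix x assume x: "x \<in> {a..b}"
    show "x \<in> (\<Union>n. U n)"
    proof (cases "x = b \<or> w = 0")
      case True
      with w x have "x = b" by auto
      have "real (Suc (N - 1)) = real N" using N0 by simp
      then have "b = a + real (Suc (N - 1)) * w" using w(3) by simp
      then have "x \<in> U (N - 1)" using N0 w(1) \<open>x = b\<close> by (auto simp: U_def algebra_simps)
      then show ?thesis by blast
    next
      case False
      with x w have wp: "0 < w" "x < b" by auto
      define n where "n = nat \<lfloor>(x - a) / w\<rfloor>"
      have nn: "real n \<le> (x - a) / w" "(x - a) / w < real n + 1"
        using x wp by (auto simp: n_def)
      then have 1: "a + real n * w \<le> x" "x \<le> a + real (Suc n) * w"
        using wp by (auto simp: field_simps)
      have "real n * w < real N * w" using 1 w wp by linarith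
      then have "n < N" using wp by simp
      then show ?thesis using 1 by (auto simp: U_def)
    qed
  qed
  then have "hausdorff1_delta \<delta> {a..b} \<le> (\<Sum>n. ennreal (diameter (U n)))"
    using w \<open>\<delta> \<in> {0<..}\<close> by (intro hausdorff1_delta_le) (simp_all add: dU, simp add: U_def)
  also have "\<dots> = (\<Sum>n<N. ennreal w)"
    by (subst suminf_finite[of "{..<N}"]) (auto simp: dU)
  also have "\<dots> = ennreal (b - a)" using w by (simp add: ennreal_of_nat_eq_real_of_nat ennreal_mult[symmetric])
  finally show "hausdorff1_delta \<delta> {a..b} \<le> ennreal (b - a)" .
qed

section \<open>Support functions and circumscribed polygons\<close>

definition support_fun :: "'a::real_inner set \<Rightarrow> 'a \<Rightarrow> real" where
  "support_fun S u = (SUP z\<in>S. z \<bullet> u)"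

lemma bdd_above_inner: "compact S \<Longrightarrow> bdd_above ((\<lambda>z. z \<bullet> u) ` S)"
  by (intro bounded_imp_bdd_above compact_imp_bounded compact_continuous_image continuous_intros)

lemma inner_le_support_fun: "compact S \<Longrightarrow> z \<in> S \<Longrightarrow> z \<bullet> u \<le> support_fun S u"
  unfolding support_fun_def by (intro cSUP_upper bdd_above_inner)

lemma support_fun_le: "S \<noteq> {} \<Longrightarrow> (\<And>z. z \<in> S \<Longrightarrow> z \<bullet> u \<le> c) \<Longrightarrow> support_fun S u \<le> c"
  unfolding support_fun_def by (intro cSUP_least)

lemma support_fun_attained:
  assumes "compact S" "S \<noteq> {}" obtains z where "z \<in> S" "z \<bullet> u = support_fun S u"
proof -
  have "continuous_on S (\<lambda>z. z \<bullet> u)" by (intro continuous_intros)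
  from continuous_attains_sup[OF assms this] obtain z where z: "z \<in> S" "\<forall>w\<in>S. w \<bullet> u \<le> z \<bullet> u" by blast
  then have "z \<bullet> u = support_fun S u"
    using assms by (intro antisym inner_le_support_fun support_fun_le) auto
  with z that show thesis by blast
qed

lemma frontier_support_vector:
  fixes K :: "'a::euclidean_space set"
  assumes K: "closed K" "convex K" "interior K \<noteq> {}" and y: "y \<in> frontier K"
  obtains n where "n \<noteq> 0" "\<And>x. x \<in> K \<Longrightarrow> x \<bullet> n \<le> y \<bullet> n" "\<And>x. x \<in> interior K \<Longrightarrow> x \<bullet> n < y \<bullet> n"
proof -
  have ri: "rel_interior K = interior K"
    using K(3) by (simp add: interior_rel_interior_gen rel_interior_nonempty_interior)
  have "y \<in> K" "y \<notin> rel_interior K" using y K(1) ri by (auto simp: frontier_def)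
  from supporting_hyperplane_rel_boundary[OF K(2) this]
  obtain a where a: "a \<noteq> 0" "\<And>x. x \<in> K \<Longrightarrow> a \<bullet> y \<le> a \<bullet> x" "\<And>x. x \<in> rel_interior K \<Longrightarrow> a \<bullet> y < a \<bullet> x"
    by metis
  show thesis
  proof
    show "x \<bullet> - a \<le> y \<bullet> - a" if "x \<in> K" for x using a(2)[OF that] by (simp add: inner_commute[of _ a])
    show "x \<bullet> - a < y \<bullet> - a" if "x \<in> interior K" for x using a(3)[of x] that ri by (simp add: inner_commute[of _ a])
  qed (use a(1) in simp)
qed

lemma maximizer_in_frontier:
  fixes K :: "'a::euclidean_space set"
  assumes x: "x \<in> K" and n: "n \<noteq> 0" and max: "\<And>y. y \<in> K \<Longrightarrow> y \<bullet> n \<le> x \<bullet> n"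
  shows "x \<in> frontier K"
proof -
  have "x \<notin> interior K"
  proof
    assume "x \<in> interior K"
    then obtain e where e: "e > 0" "ball x e \<subseteq> K" using mem_interior by blast
    have "x + (e / 2 / norm n) *\<^sub>R n \<in> K" using e n by (intro subsetD[OF e(2)]) (auto simp: dist_norm)
    from max[OF this] have "e / 2 / norm n * (n \<bullet> n) \<le> 0" by (simp add: inner_add_left)
    moreover have "0 < e / 2 / norm n * (n \<bullet> n)" using e n by simp
    ultimately show False by linarith
  qed
  then show ?thesis using x closure_subset by (auto simp: frontier_def)
qed

text \<open>The nearest-point projection onto a closed convex set is a contraction, and it sends every point of an
  outer normal ray back to the foot of the ray. So if each outer normal ray of \<open>K\<close> meets \<open>T\<close>, the projection
  maps \<open>T\<close> onto a superset of the boundary of \<open>K\<close>.\<close>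

lemma hausdorff1_frontier_le:
  fixes K T :: "complex set"
  assumes K: "closed K" "convex K" "interior K \<noteq> {}"
    and exit: "\<And>y m. y \<in> K \<Longrightarrow> m \<noteq> 0 \<Longrightarrow> \<exists>t\<ge>0. y + t *\<^sub>R m \<in> T"
  shows "hausdorff1 (frontier K) \<le> hausdorff1 T"
proof -
  have ne: "K \<noteq> {}" using K interior_subset by blast
  have "frontier K \<subseteq> closest_point K ` T"
  proof
    fix y assume y: "y \<in> frontier K"
    then have yK: "y \<in> K" using K(1) by (simp add: frontier_def)
    obtain m where m: "m \<noteq> 0" "\<And>x. x \<in> K \<Longrightarrow> x \<bullet> m \<le> y \<bullet> m"
      using frontier_support_vector[OF K y] by metis
    from exit[OF yK m(1)] obtain t where t: "t \<ge> 0" "y + t *\<^sub>R m \<in> T" by blast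
    have "dist (y + t *\<^sub>R m) y \<le> dist (y + t *\<^sub>R m) z" if "z \<in> K" for z
    proof -
      have "0 \<le> t * (m \<bullet> (y - z))" using m(2)[OF that] t by (simp add: inner_diff_right inner_commute)
      then have "(norm (t *\<^sub>R m))\<^sup>2 \<le> (norm ((y - z) + t *\<^sub>R m))\<^sup>2"
        unfolding power2_norm_eq_inner by (simp add: inner_add_left inner_add_right inner_commute)
      then have "norm (t *\<^sub>R m) \<le> norm ((y - z) + t *\<^sub>R m)" by (rule power2_le_imp_le) simp
      then show ?thesis by (simp add: dist_norm algebra_simps)
    qed
    then have "y = closest_point K (y + t *\<^sub>R m)"
      using K yK by (intro closest_point_unique) auto
    then show "y \<in> closest_point K ` T" using t by blast
  qed
  then have "hausdorff1 (frontier K) \<le> hausdorff1 (closest_point K ` T)" by (rule hausdorff1_mono)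
  also have "\<dots> \<le> ennreal 1 * hausdorff1 T"
    using closest_point_lipschitz[OF K(2,1) ne] by (intro hausdorff1_lipschitz_image_le) auto
  finally show ?thesis by simp
qed

definition dir :: "nat \<Rightarrow> nat \<Rightarrow> complex" where
  "dir n j = cis (2 * pi * real j / real n)"

lemma dir_periodic: "n > 0 \<Longrightarrow> dir n (j + n) = dir n j"
proof -
  assume "n > 0"
  then have "2 * pi * real (j + n) / real n = 2 * pi * real j / real n + 2 * pi"
    by (simp add: field_simps)
  then show ?thesis by (simp add: dir_def flip: cis_mult)
qed

lemma norm_dir [simp]: "norm (dir n j) = 1" by (simp add: dir_def)

lemma dir_Suc:
  assumes "n > 0" shows "dir n (Suc j) = cis (2 * pi / n) * dir n j"
proof -
  have "2 * pi * real (Suc j) / real n = 2 * pi / real n + 2 * pi * real j / real n"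
    using assms by (simp add: field_simps)
  then show ?thesis by (simp add: dir_def flip: cis_mult)
qed

lemma sum_shift_periodic:
  fixes f :: "nat \<Rightarrow> 'a::ab_group_add"
  assumes "f n = f 0" shows "(\<Sum>j<n. f (Suc j)) = (\<Sum>j<n. f j)"
proof -
  have "(\<Sum>j<n. f (Suc j) - f j) = f n - f 0" by (rule sum_lessThan_telescope)
  then show ?thesis using assms by (simp add: sum_subtractf)
qed

lemma polar_form: "z = norm z *\<^sub>R cis (Arg z)"
  by (cases "z = 0") (simp_all add: cis_Arg sgn_div_norm)

lemma abs_Arg_less_pi_half:
  assumes "0 < z \<bullet> n" shows "\<bar>Arg (z * cnj n)\<bar> < pi / 2"
proof -
  have "0 < Re (z * cnj n)" using assms by (simp add: inner_complex_def)
  moreover from this have "z * cnj n \<noteq> 0" by auto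
  ultimately show ?thesis using Re_Ln_pos_lt[of "z * cnj n"] by (simp add: Arg_eq_Im_Ln)
qed

lemma cis_eq_imp_int_multiple:
  assumes "cis x = cis y" obtains n :: int where "x = y + 2 * pi * n"
  using assms sin_cos_eq_iff[of x y] by (auto simp: complex_eq_iff)

text \<open>At least three equally spaced directions leave no open half-plane empty. The index is shifted to
  \<open>Suc j\<close> so that a side and its two neighbours \<open>j\<close> and \<open>Suc (Suc j)\<close> are addressed within \<open>nat\<close>.\<close>

lemma exists_dir_close:
  assumes n: "n \<ge> 3" and "m \<noteq> 0"
  shows "\<exists>j<n. 0 < m \<bullet> dir n (Suc j)"
proof -
  define \<psi> where "\<psi> = Arg m"
  define i where "i = round (\<psi> * n / (2 * pi))"
  define j where "j = nat ((i - 1) mod int n)"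
  have j: "j < n" "int j = (i - 1) mod int n" using n by (auto simp: j_def nat_less_iff)
  then obtain q where q: "int (Suc j) = i - int n * q"
    by (metis add.commute add_diff_cancel_left' diff_add_cancel minus_mult_div_eq_mod of_nat_Suc diff_diff_eq2 diff_diff_add)
  have "real (Suc j) = real_of_int (int (Suc j))" by simp
  also have "\<dots> = real_of_int i - real n * real_of_int q" unfolding q by simp
  finally have "real (Suc j) = real_of_int i - real n * real_of_int q" .
  then have "2 * pi * real (Suc j) / real n = 2 * pi * i / n - 2 * pi * q"
    using n by (simp only: right_diff_distrib diff_divide_distrib) simp
  then have d: "dir n (Suc j) = cis (2 * pi * i / n)"
    by (simp add: dir_def cis_divide[symmetric] )
  have "\<bar>\<psi> * n / (2 * pi) - i\<bar> \<le> 1/2" using of_int_round_abs_le[of "\<psi> * n / (2 * pi)"] unfolding i_def by linarith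
  then have "\<bar>\<psi> * n / (2 * pi) - i\<bar> * (2 * pi / n) \<le> 1/2 * (2 * pi / n)"
    by (intro mult_right_mono) auto
  then have "\<bar>\<psi> - 2 * pi * i / n\<bar> \<le> pi / n"
  proof -
    have "\<psi> - 2 * pi * i / n = (\<psi> * n / (2 * pi) - i) * (2 * pi / n)" using n by (simp add: field_simps)
    also have "\<bar>\<dots>\<bar> = \<bar>\<psi> * n / (2 * pi) - i\<bar> * (2 * pi / n)" by (simp add: abs_mult)
    also have "\<dots> \<le> 1/2 * (2 * pi / n)" by fact
    finally show ?thesis by simp
  qed
  also have "\<dots> < pi / 2" using n by (intro divide_strict_left_mono) auto
  finally have c: "0 < cos (\<psi> - 2 * pi * i / n)"
    by (intro cos_gt_zero_pi) (unfold abs_less_iff, linarith+)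
  have m: "m = norm m *\<^sub>R cis \<psi>" unfolding \<psi>_def by (rule polar_form)
  have "m \<bullet> dir n (Suc j) = norm m * cos (\<psi> - 2 * pi * i / n)"
    unfolding d by (subst m) (simp add: inner_complex_def cos_diff distrib_left)
  then show ?thesis using c assms(2) j by auto
qed

text \<open>Circumscribed polygon\<close>

text \<open>The equiangular polygon circumscribed about \<open>K\<close> has as its \<open>j\<close>-th side the segment on the support line
  with normal \<open>e = dir n j\<close> that is cut off by the two neighbouring support lines. In the coordinate \<open>s\<close> along
  \<open>\<i> e\<close> this is the interval from \<open>lo\<close> to \<open>hi\<close>. Its length is
  \<open>(h\<^sub>j\<^sub>+\<^sub>1 + h\<^sub>j\<^sub>-\<^sub>1 - 2 h\<^sub>j cos \<delta>) / sin \<delta>\<close>, which summed over all sides gives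
  \<open>2 tan(\<delta>/2) \<Sum> h\<^sub>j\<close>.\<close>

lemma hausdorff1_frontier_le_support_sum:
  fixes K :: "complex set"
  assumes K: "compact K" "convex K" "interior K \<noteq> {}" and n: "n \<ge> 3"
  shows "hausdorff1 (frontier K) \<le> ennreal (2 * tan (pi / n) * (\<Sum>j<n. support_fun K (dir n j)))"
proof -
  have ne: "K \<noteq> {}" using K interior_subset by blast
  define \<delta> where "\<delta> = 2 * pi / n"
  have "pi / n < pi / 2" using n by (intro divide_strict_left_mono) auto
  then have d: "0 < \<delta>" "\<delta> < pi" using n by (auto simp: \<delta>_def mult.commute)
  then have sd: "0 < sin \<delta>" by (intro sin_gt_zero)
  define h where "h j = support_fun K (dir n j)" for j
  define lo hi where "lo j = (cos \<delta> * h (Suc j) - h j) / sin \<delta>"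
    and "hi j = (h (Suc (Suc j)) - cos \<delta> * h (Suc j)) / sin \<delta>" for j
  define side where
    "side j = (\<lambda>s. h (Suc j) *\<^sub>R dir n (Suc j) + s *\<^sub>R (\<i> * dir n (Suc j))) ` {lo j..hi j}" for j
  have up: "dir n (Suc (Suc j)) = cos \<delta> *\<^sub>R dir n (Suc j) + sin \<delta> *\<^sub>R (\<i> * dir n (Suc j))" for j
    using dir_Suc[of n "Suc j"] n
    unfolding \<delta>_def[symmetric] by (simp add: complex_eq_iff)
  have down: "dir n j = cos \<delta> *\<^sub>R dir n (Suc j) - sin \<delta> *\<^sub>R (\<i> * dir n (Suc j))" for j
  proof -
    have "dir n j = cis (- \<delta>) * dir n (Suc j)"
      using dir_Suc[of n j] n by (simp add: \<delta>_def mult.assoc[symmetric] cis_mult)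
    then show ?thesis by (simp add: complex_eq_iff)
  qed
  \<comment> \<open>A point of \<open>K\<close> on the support line lies between the two neighbouring support lines.\<close>
  have lohi: "lo j \<le> hi j" for j
  proof -
    obtain a where a: "a \<in> K" "a \<bullet> dir n (Suc j) = h (Suc j)"
      using support_fun_attained[OF K(1) ne] unfolding h_def by metis
    have "a \<bullet> dir n (Suc (Suc j)) + a \<bullet> dir n j = 2 * cos \<delta> * h (Suc j)"
      unfolding up down[of j] inner_add_right inner_diff_right using a by simp
    moreover have "a \<bullet> dir n (Suc (Suc j)) \<le> h (Suc (Suc j))" "a \<bullet> dir n j \<le> h j"
      using a K(1) by (auto simp: h_def inner_le_support_fun)
    ultimately show ?thesis using sd by (simp add: lo_def hi_def divide_right_mono inner_add_right)
  qed
  have "hausdorff1 (frontier K) \<le> hausdorff1 (\<Union>j<n. side j)"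
  proof (rule hausdorff1_frontier_le[OF compact_imp_closed[OF K(1)] K(2,3)])
    fix y m :: complex assume y: "y \<in> K" and m: "m \<noteq> 0"
    define J where "J = {j. j < n \<and> 0 < m \<bullet> dir n (Suc j)}"
    define r where "r j = (h (Suc j) - y \<bullet> dir n (Suc j)) / (m \<bullet> dir n (Suc j))" for j
    have J: "finite J" "J \<noteq> {}" using exists_dir_close[OF n m] by (auto simp: J_def)
    \<comment> \<open>The first support line that the ray from \<open>y\<close> along \<open>m\<close> meets; its exit point lies on that side.\<close>
    define t where "t = Min (r ` J)"
    have yh: "y \<bullet> dir n j \<le> h j" for j using inner_le_support_fun[OF K(1) y] by (simp add: h_def)
    have t0: "0 \<le> t" unfolding t_def
      using J yh by (subst Min_ge_iff) (auto simp: r_def J_def)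
    have "t \<in> r ` J" unfolding t_def using J by (intro Min_in) auto
    then obtain j where j: "j \<in> J" "t = r j" by blast
    define z where "z = y + t *\<^sub>R m"
    have le': "z \<bullet> dir n (Suc l) \<le> h (Suc l)" if "l < n" for l
    proof (cases "l \<in> J")
      case True
      then have "t \<le> r l" using J by (simp add: t_def)
      then show ?thesis using True by (simp add: z_def r_def J_def inner_add_left field_simps)
    next
      case False
      then have "t * (m \<bullet> dir n (Suc l)) \<le> 0" using that t0 by (simp add: J_def mult_nonneg_nonpos)
      then show ?thesis using yh[of "Suc l"] by (simp add: z_def inner_add_left)
    qed
    have per: "dir n (l + n) = dir n l" "h (l + n) = h l" for l
      using dir_periodic[of n l] n by (simp_all add: h_def)
    have le: "z \<bullet> dir n l \<le> h l" if "l \<le> Suc n" for l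
    proof (cases l)
      case 0
      then show ?thesis using le'[of "n - 1"] per[of 0] n by simp
    next
      case (Suc i)
      show ?thesis
      proof (cases "i < n")
        case False
        then have "l = Suc 0 + n" using that Suc by simp
        then show ?thesis using le'[of 0] per[of "Suc 0"] n by simp
      qed (use le' Suc in auto)
    qed
    have eq: "z \<bullet> dir n (Suc j) = h (Suc j)"
      using j by (simp add: z_def r_def J_def inner_add_left)
    have jn: "j < n" using j by (simp add: J_def)
    define s where "s = z \<bullet> (\<i> * dir n (Suc j))"
    have "z = (z \<bullet> dir n (Suc j)) *\<^sub>R dir n (Suc j) + s *\<^sub>R (\<i> * dir n (Suc j))"
    proof -
      define e where "e = dir n (Suc j)"
      have ee: "Re e * Re e + Im e * Im e = 1"
        using norm_dir[of n "Suc j"] unfolding e_def[symmetric] cmod_def by (simp add: power2_eq_square)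
      have "z = (z \<bullet> e) *\<^sub>R e + (z \<bullet> (\<i> * e)) *\<^sub>R (\<i> * e)"
        unfolding complex_eq_iff inner_complex_def using ee
        by (simp, algebra)
      then show ?thesis by (simp add: e_def s_def)
    qed
    moreover have "lo j \<le> s"
      using le[of j] jn sd eq unfolding down[of j] by (simp add: lo_def s_def inner_diff_right field_simps)
    moreover have "s \<le> hi j"
      using le[of "Suc (Suc j)"] jn sd eq unfolding up by (simp add: hi_def s_def inner_add_right field_simps)
    ultimately have "z \<in> side j" unfolding side_def eq by auto
    then show "\<exists>t\<ge>0. y + t *\<^sub>R m \<in> (\<Union>j<n. side j)" using t0 jn z_def by blast
  qed
  also have "\<dots> \<le> (\<Sum>j<n. hausdorff1 (side j))" by (rule hausdorff1_UN_le) simp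
  also have "\<dots> \<le> (\<Sum>j<n. ennreal (hi j - lo j))"
  proof (rule sum_mono)
    fix j
    have "hausdorff1 (side j) \<le> ennreal 1 * hausdorff1 {lo j..hi j}"
      unfolding side_def
      by (rule hausdorff1_lipschitz_image_le) (auto simp: dist_norm norm_mult simp flip: scaleR_left_diff_distrib)
    also have "\<dots> \<le> ennreal (hi j - lo j)" using hausdorff1_Icc_le[OF lohi] by simp
    finally show "hausdorff1 (side j) \<le> ennreal (hi j - lo j)" .
  qed
  also have "\<dots> = ennreal (\<Sum>j<n. hi j - lo j)" using lohi by (simp add: sum_ennreal)
  also have "(\<Sum>j<n. hi j - lo j) = 2 * tan (pi / n) * (\<Sum>j<n. h j)"
  proof -
    have h0: "h n = h 0" "h (Suc n) = h (Suc 0)"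
      using dir_periodic[of n 0] dir_periodic[of n "Suc 0"] n by (simp_all add: h_def)
    have s1: "(\<Sum>j<n. h (Suc j)) = (\<Sum>j<n. h j)" by (rule sum_shift_periodic[OF h0(1)])
    have s2: "(\<Sum>j<n. h (Suc (Suc j))) = (\<Sum>j<n. h j)"
      using sum_shift_periodic[of "\<lambda>j. h (Suc j)" n] h0 s1 by simp
    have "(\<Sum>j<n. hi j - lo j) = (\<Sum>j<n. (h (Suc (Suc j)) + h j - 2 * cos \<delta> * h (Suc j)) / sin \<delta>)"
      by (intro sum.cong) (auto simp: hi_def lo_def diff_divide_distrib add_divide_distrib)
    also have "\<dots> = (2 - 2 * cos \<delta>) / sin \<delta> * (\<Sum>j<n. h j)"
      by (simp add: sum_divide_distrib[symmetric] sum_subtractf sum.distrib s1 s2 sum_distrib_left[symmetric])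
        (simp add: algebra_simps)
    also have "(2 - 2 * cos \<delta>) / sin \<delta> = 2 * tan (pi / n)"
    proof -
      define x where "x = pi / n"
      have x: "\<delta> = 2 * x" by (simp add: \<delta>_def x_def)
      have "2 - 2 * cos \<delta> = 4 * (sin x)\<^sup>2" unfolding x by (simp add: cos_double_sin)
      moreover have "sin \<delta> = 2 * sin x * cos x" unfolding x by (rule sin_double)
      moreover have "sin x \<noteq> 0" "cos x \<noteq> 0" using sd unfolding x sin_double by auto
      ultimately show ?thesis unfolding x_def[symmetric]
        by (simp add: tan_def power2_eq_square)
    qed
    finally show ?thesis .
  qed
  finally show ?thesis by (simp add: h_def)
qed

section \<open>Radial parametrization and inscribed polygons\<close>

text \<open>A convex set contains in its interior every point strictly between an interior point and any other point.\<close>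

lemma frontier_ray_unique:
  fixes K :: "complex set"
  assumes K: "closed K" "convex K" and o: "p \<in> interior K"
    and x: "p + a *\<^sub>R u \<in> frontier K" and y: "p + b *\<^sub>R u \<in> frontier K" and "0 \<le> a" "0 \<le> b"
  shows "a = b"
proof -
  have less: False if "a < b" "0 \<le> a" and x: "p + a *\<^sub>R u \<in> frontier K" and y: "p + b *\<^sub>R u \<in> frontier K" for a b
  proof -
    define e where "e = 1 - a / b"
    have e: "0 < e" "e \<le> 1" using that by (auto simp: e_def)
    have yK: "p + b *\<^sub>R u \<in> K" using y K by (simp add: frontier_def)
    have "(p + b *\<^sub>R u) - e *\<^sub>R ((p + b *\<^sub>R u) - p) = p + (b - e * b) *\<^sub>R u" by (simp add: algebra_simps)
    also have "b - e * b = a" using that by (simp add: e_def field_simps)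
    finally have "p + a *\<^sub>R u \<in> interior K" using mem_interior_convex_shrink[OF K(2) o yK e] by (simp only:)
    then show False using x by (simp add: frontier_def)
  qed
  show ?thesis using less[of a b] less[of b a] assms by (meson linorder_neqE_linordered_idom)
qed

text \<open>The map sending a boundary point to its direction from \<open>p\<close> is a continuous bijection from the compact
  boundary onto the unit circle, so its inverse is continuous.\<close>

lemma radial_parametrization:
  fixes K :: "complex set"
  assumes K: "compact K" "convex K" and o: "p \<in> interior K"
  obtains \<Gamma> where "continuous_on (sphere 0 1) \<Gamma>" "\<Gamma> ` sphere 0 1 = frontier K"
    "\<And>u. u \<in> sphere 0 1 \<Longrightarrow> \<exists>r>0. \<Gamma> u = p + r *\<^sub>R u"
    "\<And>u r. u \<in> sphere 0 1 \<Longrightarrow> 0 \<le> r \<Longrightarrow> p + r *\<^sub>R u \<in> frontier K \<Longrightarrow> \<Gamma> u = p + r *\<^sub>R u"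
proof -
  have cK: "closed K" using K by (simp add: compact_imp_closed)
  have pn: "p \<notin> frontier K" using o by (simp add: frontier_def)
  define f where "f z = sgn (z - p)" for z
  have cont: "continuous_on (frontier K) f"
    unfolding f_def sgn_div_norm using pn by (intro continuous_intros) auto
  have fz: "z = p + norm (z - p) *\<^sub>R f z" if "z \<in> frontier K" for z
  proof -
    have "norm (z - p) \<noteq> 0" using that pn by auto
    then show ?thesis by (simp add: f_def sgn_div_norm)
  qed
  have img: "f ` frontier K = sphere 0 1"
  proof
    show "f ` frontier K \<subseteq> sphere 0 1" using pn by (auto simp: f_def norm_sgn)
    show "sphere 0 1 \<subseteq> f ` frontier K"
    proof
      fix u :: complex assume u: "u \<in> sphere 0 1"
      obtain d where "0 < d" "p + d *\<^sub>R u \<in> frontier K"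
        using ray_to_frontier[OF compact_imp_bounded[OF K(1)] o, of u] u by (metis mem_sphere_0 norm_zero zero_neq_one)
      then show "u \<in> f ` frontier K"
        using u by (intro image_eqI[of _ _ "p + d *\<^sub>R u"]) (auto simp: f_def sgn_div_norm)
    qed
  qed
  have inj: "inj_on f (frontier K)"
  proof (rule inj_onI)
    fix x y assume xy: "x \<in> frontier K" "y \<in> frontier K" "f x = f y"
    have "norm (x - p) = norm (y - p)"
      using xy fz[of x] fz[of y] by (intro frontier_ray_unique[OF cK K(2) o, of _ "f x"]) auto
    then show "x = y" using fz[of x] fz[of y] xy by simp
  qed
  have "compact (frontier K)" using K(1) by (rule compact_frontier)
  from homeomorphism_compact[OF this cont img inj] obtain \<Gamma> where
    h: "homeomorphism (frontier K) (sphere 0 1) f \<Gamma>" by blast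
  have im: "\<Gamma> ` sphere 0 1 = frontier K" and fG: "\<And>u. u \<in> sphere 0 1 \<Longrightarrow> f (\<Gamma> u) = u"
    using h by (auto simp: homeomorphism_def)
  show thesis
  proof
    show "continuous_on (sphere 0 1) \<Gamma>" using h by (simp add: homeomorphism_def)
    show "\<Gamma> ` sphere 0 1 = frontier K" by fact
    show ex: "\<exists>r>0. \<Gamma> u = p + r *\<^sub>R u" if u: "u \<in> sphere 0 1" for u
    proof -
      have G: "\<Gamma> u \<in> frontier K" using im u by blast
      then show ?thesis using fz[OF G] fG[OF u] pn by (intro exI[of _ "norm (\<Gamma> u - p)"]) auto
    qed
    show "\<Gamma> u = p + r *\<^sub>R u" if u: "u \<in> sphere 0 1" "0 \<le> r" "p + r *\<^sub>R u \<in> frontier K" for u r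
    proof -
      obtain s where s: "s > 0" "\<Gamma> u = p + s *\<^sub>R u" using ex u by blast
      have "\<Gamma> u \<in> frontier K" using im u by blast
      then have "s = r" using s u by (intro frontier_ray_unique[OF cK K(2) o]) auto
      then show ?thesis using s by simp
    qed
  qed
qed

lemma cis_inj_on_period: "inj_on cis {a<..<a + 2 * pi}"
proof (rule inj_onI)
  fix x y assume xy: "x \<in> {a<..<a + 2 * pi}" "y \<in> {a<..<a + 2 * pi}" "cis x = cis y"
  then obtain n :: int where n: "x = y + 2 * pi * n" using cis_eq_imp_int_multiple by blast
  have "\<bar>x - y\<bar> < 2 * pi" using xy by auto
  then have "\<bar>real_of_int n\<bar> * (2 * pi) < 1 * (2 * pi)" using n by (simp add: abs_mult)
  then have "\<bar>real_of_int n\<bar> < 1" using mult_less_cancel_right_pos[of "2*pi"] by auto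
  then have "n = 0" by linarith
  then show "x = y" using n by simp
qed

text \<open>The boundary arcs between consecutive vertices are connected, so each has measure at least the length of
  its chord. The arcs share endpoints, so they are first shortened by a proportion \<open>s\<close> at both ends, which makes them
  disjoint compact sets, and then \<open>s\<close> tends to \<open>0\<close>.\<close>

lemma inscribed_polygon_le_hausdorff1:
  fixes K :: "complex set" and \<tau> :: "nat \<Rightarrow> real"
  assumes K: "compact K" "convex K" and o: "p \<in> interior K"
    and \<tau>: "\<And>j. j < n \<Longrightarrow> \<tau> j \<le> \<tau> (Suc j)" "\<tau> n \<le> \<tau> 0 + 2 * pi"
    and r: "\<And>j. j \<le> n \<Longrightarrow> 0 \<le> r j" "\<And>j. j \<le> n \<Longrightarrow> p + r j *\<^sub>R cis (\<tau> j) \<in> frontier K"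
  shows "ennreal (\<Sum>j<n. dist (p + r j *\<^sub>R cis (\<tau> j)) (p + r (Suc j) *\<^sub>R cis (\<tau> (Suc j)))) \<le> hausdorff1 (frontier K)"
proof (cases "hausdorff1 (frontier K) = top")
  case False
  then obtain H where H: "0 \<le> H" "hausdorff1 (frontier K) = ennreal H" by (metis ennreal_cases)
  obtain \<Gamma> where \<Gamma>: "continuous_on (sphere 0 1) \<Gamma>" "\<Gamma> ` sphere 0 1 = frontier K"
    "\<And>u. u \<in> sphere 0 1 \<Longrightarrow> \<exists>r>0. \<Gamma> u = p + r *\<^sub>R u"
    "\<And>u r. u \<in> sphere 0 1 \<Longrightarrow> 0 \<le> r \<Longrightarrow> p + r *\<^sub>R u \<in> frontier K \<Longrightarrow> \<Gamma> u = p + r *\<^sub>R u"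
    using radial_parametrization[OF K o] by metis
  define G where "G t = \<Gamma> (cis t)" for t
  have Gc: "continuous_on T G" for T
    unfolding G_def by (rule continuous_on_compose2[OF \<Gamma>(1)]) (auto intro!: continuous_intros)
  have Gj: "G (\<tau> j) = p + r j *\<^sub>R cis (\<tau> j)" if "j \<le> n" for j
    using \<Gamma>(4)[of "cis (\<tau> j)" "r j"] r that by (simp add: G_def)
  have Ginj: "inj_on G {\<tau> 0<..<\<tau> 0 + 2 * pi}"
  proof (rule inj_onI)
    fix x y assume xy: "x \<in> {\<tau> 0<..<\<tau> 0 + 2 * pi}" "y \<in> {\<tau> 0<..<\<tau> 0 + 2 * pi}" "G x = G y"
    obtain a b where ab: "a > 0" "b > 0" "G x = p + a *\<^sub>R cis x" "G y = p + b *\<^sub>R cis y"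
      using \<Gamma>(3)[of "cis x"] \<Gamma>(3)[of "cis y"] by (auto simp: G_def)
    then have eq: "a *\<^sub>R cis x = b *\<^sub>R cis y" using xy by simp
    then have "norm (a *\<^sub>R cis x) = norm (b *\<^sub>R cis y)" by simp
    then have "a = b" using ab by simp
    then have "cis x = cis y" using eq ab by simp
    then show "x = y" using cis_inj_on_period[of "\<tau> 0"] xy by (auto simp: inj_on_def)
  qed
  have mono: "\<tau> i \<le> \<tau> j" if "i \<le> j" "j \<le> n" for i j
    using that
  proof (induction rule: dec_induct)
    case (step m)
    then show ?case using \<tau>(1)[of m] by linarith
  qed simp
  \<comment> \<open>Vertices that coincide would give overlapping one-point arcs; they contribute chords of length \<open>0\<close>.\<close>
  define I where "I = {j. j < n \<and> \<tau> j < \<tau> (Suc j)}"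
  define lo hi where "lo s j = \<tau> j + s * (\<tau> (Suc j) - \<tau> j)"
    and "hi s j = \<tau> (Suc j) - s * (\<tau> (Suc j) - \<tau> j)" for s j
  have bound: "(\<Sum>j<n. dist (G (lo s j)) (G (hi s j))) \<le> H" if s: "0 < s" "s < 1/2" for s
  proof -
    have sub: "\<tau> j < lo s j \<and> lo s j < hi s j \<and> hi s j < \<tau> (Suc j)" if "j \<in> I" for j
    proof -
      define d where "d = \<tau> (Suc j) - \<tau> j"
      have "0 < d" using that by (simp add: d_def I_def)
      then have "0 < s * d" "s * d < 1/2 * d" using s by (auto intro: mult_strict_right_mono)
      then show ?thesis unfolding lo_def hi_def d_def[symmetric] using d_def by linarith
    qed
    define P where "P j = G ` {lo s j..hi s j}" for j
    have range: "{lo s j..hi s j} \<subseteq> {\<tau> 0<..<\<tau> 0 + 2 * pi}" if "j \<in> I" for j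
      using sub[OF that] mono[of 0 j] mono[of "Suc j" n] \<tau>(2) that by (auto simp: I_def)
    have disj: "disjoint_family_on P I"
      unfolding disjoint_family_on_def
    proof (intro ballI impI)
      have *: "{lo s i..hi s i} \<inter> {lo s j..hi s j} = {}" if "i \<in> I" "j \<in> I" "i < j" for i j
        using sub[OF that(1)] sub[OF that(2)] mono[of "Suc i" j] that by (auto simp: I_def)
      fix i j assume ij: "i \<in> I" "j \<in> I" "i \<noteq> j"
      then have "{lo s i..hi s i} \<inter> {lo s j..hi s j} = {}"
        using *[of i j] *[of j i] by (metis inf_commute linorder_neqE_nat)
      then show "P i \<inter> P j = {}"
        unfolding P_def using inj_on_image_Int[OF Ginj range[OF ij(1)] range[OF ij(2)]] by simp
    qed
    have "(\<Sum>j\<in>I. ennreal (dist (G (lo s j)) (G (hi s j)))) \<le> (\<Sum>j\<in>I. hausdorff1 (P j))"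
    proof (intro sum_mono dist_le_hausdorff1_connected)
      fix j assume "j \<in> I"
      then show "G (lo s j) \<in> P j" "G (hi s j) \<in> P j" using sub[of j] by (auto simp: P_def)
      show "connected (P j)" unfolding P_def by (intro connected_continuous_image Gc) auto
    qed
    also have "\<dots> \<le> hausdorff1 (\<Union>j\<in>I. P j)"
    proof (intro hausdorff1_disjoint_compact_UN disj)
      show "compact (P j)" for j unfolding P_def by (intro compact_continuous_image Gc) auto
    qed (simp add: I_def)
    also have "\<dots> \<le> hausdorff1 (frontier K)"
      using \<Gamma>(2) by (intro hausdorff1_mono) (auto simp: P_def G_def)
    finally have "(\<Sum>j\<in>I. ennreal (dist (G (lo s j)) (G (hi s j)))) \<le> ennreal H" using H by simp
    then have "(\<Sum>j\<in>I. dist (G (lo s j)) (G (hi s j))) \<le> H" using H by (simp add: sum_ennreal)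
    moreover have "(\<Sum>j<n. dist (G (lo s j)) (G (hi s j))) = (\<Sum>j\<in>I. dist (G (lo s j)) (G (hi s j)))"
    proof (rule sum.mono_neutral_right)
      show "\<forall>j\<in>{..<n} - I. dist (G (lo s j)) (G (hi s j)) = 0"
      proof
        fix j assume "j \<in> {..<n} - I"
        then have "\<tau> (Suc j) = \<tau> j" using \<tau>(1)[of j] by (auto simp: I_def)
        then show "dist (G (lo s j)) (G (hi s j)) = 0" by (simp add: lo_def hi_def)
      qed
    qed (auto simp: I_def)
    ultimately show ?thesis by simp
  qed
  have "((\<lambda>s. \<Sum>j<n. dist (G (lo s j)) (G (hi s j))) \<longlongrightarrow> (\<Sum>j<n. dist (G (lo 0 j)) (G (hi 0 j)))) (at_right 0)"
  proof (intro tendsto_sum tendsto_dist)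
    have G0: "isCont G t" for t using Gc[of UNIV] by (simp add: continuous_on_eq_continuous_at)
    fix j
    have "((\<lambda>s. lo s j) \<longlongrightarrow> lo 0 j) (at_right 0)" "((\<lambda>s. hi s j) \<longlongrightarrow> hi 0 j) (at_right 0)"
      unfolding lo_def hi_def by (intro tendsto_intros)+
    then show "((\<lambda>s. G (lo s j)) \<longlongrightarrow> G (lo 0 j)) (at_right 0)" "((\<lambda>s. G (hi s j)) \<longlongrightarrow> G (hi 0 j)) (at_right 0)"
      using isCont_tendsto_compose[OF G0] by blast+
  qed
  moreover have "\<forall>\<^sub>F s in at_right 0. (\<Sum>j<n. dist (G (lo s j)) (G (hi s j))) \<le> H"
    using eventually_at_right_less[of 0] eventually_at_right_real[of 0 "1/2"]
    by (auto elim!: eventually_mono intro!: bound)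
  ultimately have "(\<Sum>j<n. dist (G (lo 0 j)) (G (hi 0 j))) \<le> H"
    by (intro tendsto_upperbound) auto
  moreover have "(\<Sum>j<n. dist (G (lo 0 j)) (G (hi 0 j)))
      = (\<Sum>j<n. dist (p + r j *\<^sub>R cis (\<tau> j)) (p + r (Suc j) *\<^sub>R cis (\<tau> (Suc j))))"
    by (intro sum.cong) (auto simp: lo_def hi_def Gj)
  ultimately show ?thesis using H by (simp add: ennreal_leI)
qed simp

text \<open>Suppose \<open>r cis \<tau>\<close> and \<open>s cis \<tau>'\<close> maximize the inner product with \<open>cis \<theta>\<close> and
  \<open>cis \<theta>'\<close> respectively, among the two points. Multiplying the two inequalities and using
  \<open>cos (\<tau> - \<theta>) cos (\<tau>' - \<theta>') - cos (\<tau>' - \<theta>) cos (\<tau> - \<theta>') = - sin (\<tau> - \<tau>') sin (\<theta>' - \<theta>)\<close>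
  shows that the points turn in the same sense as the directions.\<close>

lemma polar_angle_support_mono:
  fixes r s \<tau> \<tau>' \<theta> \<theta>' :: real
  assumes \<theta>: "\<theta> < \<theta>'" "\<theta>' < \<theta> + pi" and rs: "0 < r" "0 < s"
    and \<tau>: "\<bar>\<tau> - \<theta>\<bar> < pi / 2" "\<bar>\<tau>' - \<theta>'\<bar> < pi / 2"
    and m1: "s * cos (\<tau>' - \<theta>) \<le> r * cos (\<tau> - \<theta>)"
    and m2: "r * cos (\<tau> - \<theta>') \<le> s * cos (\<tau>' - \<theta>')"
  shows "\<tau> \<le> \<tau>'"
proof (rule ccontr)
  assume "\<not> \<tau> \<le> \<tau>'"
  then have l: "\<tau>' < \<tau>" by simp
  have b: "\<tau> - \<theta> < pi/2" "-(pi/2) < \<tau> - \<theta>" "\<tau>' - \<theta>' < pi/2" "-(pi/2) < \<tau>' - \<theta>'"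
    using \<tau> by linarith+
  have "0 < cos (\<tau> - \<theta>)" "0 < cos (\<tau>' - \<theta>')" "0 < cos (\<tau>' - \<theta>)" "0 < cos (\<tau> - \<theta>')"
    using b l \<theta> by (auto intro!: cos_gt_zero_pi)
  then have "(s * cos (\<tau>' - \<theta>)) * (r * cos (\<tau> - \<theta>')) \<le> (r * cos (\<tau> - \<theta>)) * (s * cos (\<tau>' - \<theta>'))"
    using rs by (intro mult_mono m1 m2 mult_nonneg_nonneg) auto
  then have "(r * s) * (cos (\<tau>' - \<theta>) * cos (\<tau> - \<theta>')) \<le> (r * s) * (cos (\<tau> - \<theta>) * cos (\<tau>' - \<theta>'))"
    by (simp add: mult_ac)
  then have "cos (\<tau>' - \<theta>) * cos (\<tau> - \<theta>') \<le> cos (\<tau> - \<theta>) * cos (\<tau>' - \<theta>')"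
    using rs by simp
  moreover have "cos (\<tau> - \<theta>) * cos (\<tau>' - \<theta>') - cos (\<tau>' - \<theta>) * cos (\<tau> - \<theta>') = - (sin (\<tau> - \<tau>') * sin (\<theta>' - \<theta>))"
  proof -
    have pyth: "(sin x)\<^sup>2 = 1 - (cos x)\<^sup>2" for x :: real by (simp add: sin_squared_eq)
    show ?thesis unfolding cos_diff sin_diff by algebra
  qed
  moreover have "0 < sin (\<tau> - \<tau>')" using b l \<theta> by (intro sin_gt_zero) linarith+
  moreover have "0 < sin (\<theta>' - \<theta>)" using \<theta> by (intro sin_gt_zero) linarith+
  ultimately show False using mult_pos_pos[of "sin (\<tau> - \<tau>')" "sin (\<theta>' - \<theta>)"] by linarith
qed

text \<open>Let \<open>a\<^sub>j\<close> be a point of \<open>K\<close> where the support in direction \<open>dir n j\<close> is attained. Seen from an interior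
  point these are in counterclockwise order, so the polygon through them is inscribed in the boundary. Each chord
  is at least its component along the bisecting direction
  \<open>f\<^sub>j = \<i> cis (\<theta>\<^sub>j + \<pi>/n)\<close>; summation by parts turns the sum of these components into
  \<open>2 sin(\<pi>/n)\<close> times the sum of the support values.\<close>

lemma support_sum_le_hausdorff1_frontier:
  fixes K :: "complex set"
  assumes K: "compact K" "convex K" "interior K \<noteq> {}" and n: "n \<ge> 3"
  shows "ennreal (2 * sin (pi / n) * (\<Sum>j<n. support_fun K (dir n j))) \<le> hausdorff1 (frontier K)"
proof -
  have ne: "K \<noteq> {}" using K interior_subset by blast
  have cK: "closed K" using K(1) by (rule compact_imp_closed)
  obtain p where p: "p \<in> interior K" using K by blast
  have "\<exists>a\<in>K. a \<bullet> u = support_fun K u" for u using support_fun_attained[OF K(1) ne] by metis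
  then obtain a where a: "\<And>u. a u \<in> K" "\<And>u. a u \<bullet> u = support_fun K u" by metis
  have a_gt: "0 < (a u - p) \<bullet> u" if "u \<noteq> 0" for u
  proof -
    obtain e where e: "e > 0" "ball p e \<subseteq> K" using p mem_interior by blast
    have "p + (e / 2 / norm u) *\<^sub>R u \<in> K" using e that by (intro subsetD[OF e(2)]) (auto simp: dist_norm)
    from inner_le_support_fun[OF K(1) this, of u] a(2)[of u]
    have "e / 2 / norm u * (u \<bullet> u) \<le> (a u - p) \<bullet> u" by (simp add: inner_add_left inner_diff_left)
    moreover have "0 < e / 2 / norm u * (u \<bullet> u)" using e that by simp
    ultimately show ?thesis by linarith
  qed
  have a_fr: "a u \<in> frontier K" if "u \<noteq> 0" for u
    using inner_le_support_fun[OF K(1), of _ u] a(2)[of u] by (intro maximizer_in_frontier[OF a(1) that]) simp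
  define \<theta> where "\<theta> j = 2 * pi * real j / real n" for j
  \<comment> \<open>A lift of the polar angle of \<open>v j\<close> that stays within \<open>\<pi>/2\<close> of \<open>\<theta> j\<close>, so it grows by \<open>2\<pi>\<close> in one turn.\<close>
  define v where "v j = a (dir n j) - p" for j
  define \<tau> where "\<tau> j = \<theta> j + Arg (v j * cnj (dir n j))" for j
  define r where "r j = norm (v j)" for j
  have dir0: "dir n j \<noteq> 0" for j using norm_dir[of n j] by force
  have v0: "v j \<noteq> 0" for j using a_gt[OF dir0, of j] by (auto simp: v_def)
  have dirc: "dir n j = cis (\<theta> j)" for j by (simp add: dir_def \<theta>_def)
  have vpol: "v j = r j *\<^sub>R cis (\<tau> j)" for j
  proof -
    define w where "w = v j * cnj (dir n j)"
    have "w = norm w *\<^sub>R cis (Arg w)" by (rule polar_form)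
    moreover have "norm w = r j" by (simp add: w_def r_def norm_mult)
    ultimately have "w * cis (\<theta> j) = (r j *\<^sub>R cis (Arg w)) * cis (\<theta> j)" by metis
    also have "\<dots> = r j *\<^sub>R cis (\<tau> j)" by (simp add: \<tau>_def w_def[symmetric] cis_mult add.commute)
    finally have "w * cis (\<theta> j) = r j *\<^sub>R cis (\<tau> j)" .
    moreover have "w * cis (\<theta> j) = v j" by (simp add: w_def dirc cis_cnj cis_mult mult.assoc)
    ultimately show ?thesis by simp
  qed
  have \<tau>_close: "\<bar>\<tau> j - \<theta> j\<bar> < pi / 2" for j
    using abs_Arg_less_pi_half[of "v j" "dir n j"] a_gt[OF dir0, of j] by (simp add: \<tau>_def v_def)
  have inner: "v i \<bullet> dir n j = r i * cos (\<tau> i - \<theta> j)" for i j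
    unfolding vpol dirc by (simp add: inner_complex_def cos_diff distrib_left)
  have v_max: "v i \<bullet> dir n j \<le> v j \<bullet> dir n j" for i j
    using inner_le_support_fun[OF K(1) a(1)[of "dir n i"], of "dir n j"] a(2)[of "dir n j"]
    by (simp add: v_def inner_diff_left)
  have "pi / n < pi / 2" using n by (intro divide_strict_left_mono) auto
  then have d: "\<theta> (Suc j) = \<theta> j + 2 * (pi / n)" "2 * (pi / n) < pi" for j
    using n by (auto simp: \<theta>_def field_simps)
  have mono: "\<tau> j \<le> \<tau> (Suc j)" for j
  proof (rule polar_angle_support_mono[of "\<theta> j" "\<theta> (Suc j)" "r j" "r (Suc j)"])
    show "0 < r j" "0 < r (Suc j)" using v0 by (auto simp: r_def)
    show "r (Suc j) * cos (\<tau> (Suc j) - \<theta> j) \<le> r j * cos (\<tau> j - \<theta> j)" using v_max[of "Suc j" j] by (simp add: inner)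
    show "r j * cos (\<tau> j - \<theta> (Suc j)) \<le> r (Suc j) * cos (\<tau> (Suc j) - \<theta> (Suc j))" using v_max[of j "Suc j"] by (simp add: inner)
    show "\<bar>\<tau> j - \<theta> j\<bar> < pi / 2" "\<bar>\<tau> (Suc j) - \<theta> (Suc j)\<bar> < pi / 2" by (rule \<tau>_close)+
  qed (use d n in auto)
  have dn: "dir n n = dir n 0" using dir_periodic[of n 0] n by simp
  have vn: "v n = v 0" by (simp add: v_def dn)
  have \<tau>n: "\<tau> n = \<tau> 0 + 2 * pi" using n by (simp add: \<tau>_def vn dn \<theta>_def)
  have "ennreal (\<Sum>j<n. dist (p + r j *\<^sub>R cis (\<tau> j)) (p + r (Suc j) *\<^sub>R cis (\<tau> (Suc j)))) \<le> hausdorff1 (frontier K)"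
  proof (rule inscribed_polygon_le_hausdorff1[OF K(1,2) p])
    show "p + r j *\<^sub>R cis (\<tau> j) \<in> frontier K" for j
      using a_fr[OF dir0, of j] unfolding vpol[symmetric] by (simp add: v_def)
  qed (use mono \<tau>n in \<open>auto simp: r_def\<close>)
  moreover have "2 * sin (pi / n) * (\<Sum>j<n. support_fun K (dir n j))
      \<le> (\<Sum>j<n. dist (p + r j *\<^sub>R cis (\<tau> j)) (p + r (Suc j) *\<^sub>R cis (\<tau> (Suc j))))"
  proof -
    define x where "x = pi / n"
    define f where "f j = \<i> * cis (\<theta> j + x)" for j
    have th: "\<theta> (Suc j) = \<theta> j + 2 * x" for j using d by (simp add: x_def)
    have fd: "f j - f (Suc j) = (2 * sin x) *\<^sub>R dir n (Suc j)" for j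
    proof -
      have 1: "\<theta> j + x = \<theta> (Suc j) - x" by (simp add: th)
      show ?thesis unfolding f_def 1 dirc
        by (simp add: complex_eq_iff cos_add sin_add cos_diff sin_diff algebra_simps)
    qed
    have fn: "f n = f 0" using cis_mult[of "\<theta> 0 + x" "2 * pi"] n by (simp add: f_def \<theta>_def add.commute)
    have "2 * sin x * (\<Sum>j<n. support_fun K (dir n j)) = 2 * sin x * (\<Sum>j<n. support_fun K (dir n (Suc j)))"
      using sum_shift_periodic[of "\<lambda>j. support_fun K (dir n j)" n] dn by simp
    also have "\<dots> = (\<Sum>j<n. a (dir n (Suc j)) \<bullet> (f j - f (Suc j)))"
      by (simp add: fd a(2) sum_distrib_left)
    also have "\<dots> = (\<Sum>j<n. a (dir n (Suc j)) \<bullet> f j) - (\<Sum>j<n. a (dir n (Suc j)) \<bullet> f (Suc j))"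
      by (simp add: inner_diff_right sum_subtractf)
    also have "(\<Sum>j<n. a (dir n (Suc j)) \<bullet> f (Suc j)) = (\<Sum>j<n. a (dir n j) \<bullet> f j)"
      by (rule sum_shift_periodic) (simp add: dn fn)
    also have "(\<Sum>j<n. a (dir n (Suc j)) \<bullet> f j) - \<dots> = (\<Sum>j<n. (a (dir n (Suc j)) - a (dir n j)) \<bullet> f j)"
      by (simp add: inner_diff_left sum_subtractf)
    also have "\<dots> \<le> (\<Sum>j<n. dist (a (dir n j)) (a (dir n (Suc j))))"
    proof (rule sum_mono)
      fix j
      have "(a (dir n (Suc j)) - a (dir n j)) \<bullet> f j \<le> norm (a (dir n (Suc j)) - a (dir n j)) * norm (f j)"
        by (rule norm_cauchy_schwarz)
      then show "(a (dir n (Suc j)) - a (dir n j)) \<bullet> f j \<le> dist (a (dir n j)) (a (dir n (Suc j)))"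
        by (simp add: f_def norm_mult dist_norm norm_minus_commute)
    qed
    also have "\<dots> = (\<Sum>j<n. dist (p + r j *\<^sub>R cis (\<tau> j)) (p + r (Suc j) *\<^sub>R cis (\<tau> (Suc j))))"
      unfolding vpol[symmetric] by (simp add: v_def)
    finally show ?thesis by (simp add: x_def)
  qed
  ultimately show ?thesis by (meson ennreal_leI order_trans)
qed

section \<open>Perimeter of Minkowski combinations\<close>

definition minkowski_mix :: "real \<Rightarrow> 'a::real_vector set \<Rightarrow> 'a set \<Rightarrow> 'a set" where
  "minkowski_mix t A B = (\<lambda>(x, y). (1 - t) *\<^sub>R x + t *\<^sub>R y) ` (A \<times> B)"

lemma minkowski_mixI: "x \<in> A \<Longrightarrow> y \<in> B \<Longrightarrow> (1 - t) *\<^sub>R x + t *\<^sub>R y \<in> minkowski_mix t A B"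
  unfolding minkowski_mix_def by (rule image_eqI[of _ _ "(x, y)"]) auto

lemma compact_minkowski_mix:
  fixes A B :: "'a::real_normed_vector set"
  shows "compact A \<Longrightarrow> compact B \<Longrightarrow> compact (minkowski_mix t A B)"
  unfolding minkowski_mix_def split_def
  by (intro compact_continuous_image compact_Times continuous_intros)

lemma convex_minkowski_mix:
  assumes "convex A" "convex B" shows "convex (minkowski_mix t A B)"
proof -
  have "linear (\<lambda>z. (1 - t) *\<^sub>R fst z + t *\<^sub>R snd z :: 'a)"
    by (rule linearI) (simp_all add: algebra_simps)
  then show ?thesis
    unfolding minkowski_mix_def split_def using assms by (intro convex_linear_image convex_Times)
qed

lemma interior_minkowski_mix:
  fixes A B :: "'a::real_normed_vector set"
  assumes "interior A \<noteq> {}" "interior B \<noteq> {}"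
  shows "interior (minkowski_mix t A B) \<noteq> {}"
proof -
  have *: "interior T \<noteq> {}" if "interior S \<noteq> {}" "c \<noteq> 0" "(\<lambda>x. b + c *\<^sub>R x) ` S \<subseteq> T" for S T :: "'a set" and b c
  proof -
    have "open ((+) b ` ((*\<^sub>R) c ` interior S))"
      using that by (intro open_translation open_scaling open_interior)
    moreover have "(+) b ` ((*\<^sub>R) c ` interior S) \<subseteq> T" using that(3) interior_subset[of S] by blast
    ultimately have "(+) b ` ((*\<^sub>R) c ` interior S) \<subseteq> interior T" by (rule interior_maximal[rotated])
    then show ?thesis using that(1) by auto
  qed
  obtain a b where ab: "a \<in> A" "b \<in> B" using assms interior_subset by blast
  show ?thesis
  proof (cases "t = 0")
    case True
    show ?thesis
    proof (rule *[of A 1 0])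
      show "(\<lambda>x. 0 + 1 *\<^sub>R x) ` A \<subseteq> minkowski_mix t A B"
        using minkowski_mixI[of _ A b B t] ab True by auto
    qed (use assms in auto)
  next
    case False
    show ?thesis
    proof (rule *[of B t "(1 - t) *\<^sub>R a"])
      show "(\<lambda>x. (1 - t) *\<^sub>R a + t *\<^sub>R x) ` B \<subseteq> minkowski_mix t A B"
        using minkowski_mixI[OF ab(1), of _ B t] by auto
    qed (use assms False in auto)
  qed
qed

lemma support_fun_minkowski_mix_le:
  assumes "compact A" "A \<noteq> {}" "compact B" "B \<noteq> {}" "0 \<le> t" "t \<le> 1"
  shows "support_fun (minkowski_mix t A B) u \<le> (1 - t) * support_fun A u + t * support_fun B u"
proof (rule support_fun_le)
  show "minkowski_mix t A B \<noteq> {}" using assms by (auto simp: minkowski_mix_def)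
  fix z assume "z \<in> minkowski_mix t A B"
  then obtain x y where xy: "x \<in> A" "y \<in> B" "z = (1 - t) *\<^sub>R x + t *\<^sub>R y" by (auto simp: minkowski_mix_def)
  then have "z \<bullet> u = (1 - t) * (x \<bullet> u) + t * (y \<bullet> u)" by (simp add: inner_add_left)
  also have "\<dots> \<le> (1 - t) * support_fun A u + t * support_fun B u"
    using assms xy by (intro add_mono mult_left_mono inner_le_support_fun) auto
  finally show "z \<bullet> u \<le> (1 - t) * support_fun A u + t * support_fun B u" .
qed

lemma perimeter_finite:
  assumes "compact K" "convex K" "interior K \<noteq> {}" shows "perimeter K < top"
  using le_less_trans[OF hausdorff1_frontier_le_support_sum[OF assms order_refl] ennreal_less_top]
  by (simp add: perimeter_def)

text \<open>The boundary is connected and has two distinct points.\<close>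

lemma perimeter_pos:
  assumes K: "compact K" "convex K" "interior K \<noteq> {}" shows "0 < perimeter K"
proof -
  obtain p where p: "p \<in> interior K" using K by blast
  obtain \<Gamma> where \<Gamma>: "continuous_on (sphere 0 1) \<Gamma>" "\<Gamma> ` sphere 0 1 = frontier K"
    "\<And>u. u \<in> sphere 0 1 \<Longrightarrow> \<exists>r>0. \<Gamma> u = p + r *\<^sub>R u"
    using radial_parametrization[OF K(1,2) p] by metis
  have "connected (frontier K)"
    unfolding \<Gamma>(2)[symmetric] by (intro connected_continuous_image \<Gamma>(1) connected_sphere) simp
  moreover have "\<Gamma> 1 \<in> frontier K" "\<Gamma> (-1) \<in> frontier K" using \<Gamma>(2) by auto
  ultimately have "ennreal (dist (\<Gamma> 1) (\<Gamma> (-1))) \<le> perimeter K"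
    unfolding perimeter_def by (rule dist_le_hausdorff1_connected)
  moreover obtain r s where "r > 0" "s > 0" "\<Gamma> 1 = p + r *\<^sub>R 1" "\<Gamma> (-1) = p + s *\<^sub>R (-1)"
    using \<Gamma>(3)[of 1] \<Gamma>(3)[of "-1"] by auto
  then have "\<Gamma> 1 \<noteq> \<Gamma> (-1)" by (simp add: complex_eq_iff)
  ultimately show ?thesis 
    using less_le_trans[of 0 "ennreal (dist (\<Gamma> 1) (\<Gamma> (-1)))"] by simp
qed

text \<open>Apply the upper polygon bound to the combination and the lower one to the two summands. The support sums
  cancel up to the factor \<open>cos(\<pi>/n)\<close>, which tends to \<open>1\<close>.\<close>

theorem perimeter_minkowski_mix_le:
  assumes A: "compact A" "convex A" "interior A \<noteq> {}" and B: "compact B" "convex B" "interior B \<noteq> {}"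
    and t: "0 \<le> t" "t \<le> 1"
  shows "perimeter (minkowski_mix t A B) \<le> ennreal (1 - t) * perimeter A + ennreal t * perimeter B"
proof -
  let ?M = "minkowski_mix t A B"
  have M: "compact ?M" "convex ?M" "interior ?M \<noteq> {}"
    using A B by (simp_all add: compact_minkowski_mix convex_minkowski_mix interior_minkowski_mix)
  have ne: "A \<noteq> {}" "B \<noteq> {}" using A B interior_subset by blast+
  obtain a where a: "0 \<le> a" "perimeter A = ennreal a" using perimeter_finite[OF A] by (metis ennreal_cases less_irrefl)
  obtain b where b: "0 \<le> b" "perimeter B = ennreal b" using perimeter_finite[OF B] by (metis ennreal_cases less_irrefl)
  obtain m where m: "0 \<le> m" "perimeter ?M = ennreal m" using perimeter_finite[OF M] by (metis ennreal_cases less_irrefl)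
  define c where "c = (1 - t) * a + t * b"
  have c0: "0 \<le> c" using a b t by (simp add: c_def)
  have "cos (pi / n) * m \<le> c" if n: "n \<ge> 3" for n :: nat
  proof -
    have q: "pi / n < pi / 2" using n by (intro divide_strict_left_mono) auto
    then have cs: "0 < cos (pi / n)" "0 < sin (pi / n)"
      using n by (auto intro!: cos_gt_zero sin_gt_zero2)
    define h where "h K = (\<Sum>j<n. support_fun K (dir n j))" for K
    have "ennreal m \<le> ennreal (2 * tan (pi / n) * h ?M)"
      using hausdorff1_frontier_le_support_sum[OF M n] m by (simp add: perimeter_def h_def)
    then have "m \<le> max 0 (2 * tan (pi / n) * h ?M)" using m(1) by (auto simp: ennreal_le_iff2)
    then have "cos (pi / n) * m \<le> cos (pi / n) * max 0 (2 * tan (pi / n) * h ?M)"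
      using cs by (intro mult_left_mono) auto
    also have "\<dots> = max 0 (2 * sin (pi / n) * h ?M)"
      using cs by (simp add: max_mult_distrib_left tan_def)
    also have "2 * sin (pi / n) * h ?M \<le> 2 * sin (pi / n) * ((1 - t) * h A + t * h B)"
    proof (intro mult_left_mono)
      show "h ?M \<le> (1 - t) * h A + t * h B"
        unfolding h_def sum_distrib_left sum.distrib[symmetric]
        using A B ne t by (intro sum_mono support_fun_minkowski_mix_le)
    qed (use cs in auto)
    also have "\<dots> = (1 - t) * (2 * sin (pi / n) * h A) + t * (2 * sin (pi / n) * h B)" by algebra
    also have "\<dots> \<le> c" unfolding c_def
    proof (intro add_mono mult_left_mono)
      show "2 * sin (pi / n) * h A \<le> a"
        using support_sum_le_hausdorff1_frontier[OF A n] a by (simp add: perimeter_def h_def)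
      show "2 * sin (pi / n) * h B \<le> b"
        using support_sum_le_hausdorff1_frontier[OF B n] b by (simp add: perimeter_def h_def)
    qed (use t in auto)
    finally show ?thesis using c0 by simp
  qed
  moreover have "(\<lambda>n. cos (pi / real n) * m) \<longlonglongrightarrow> cos 0 * m"
    by (intro tendsto_intros tendsto_divide_0[OF tendsto_const] filterlim_real_sequentially[THEN filterlim_at_top_imp_at_infinity])
  ultimately have "cos 0 * m \<le> c"
    by (intro LIMSEQ_le_const2) (auto intro!: exI[of _ 3])
  then have "ennreal m \<le> ennreal c" by (intro ennreal_leI) simp
  also have "ennreal c = ennreal (1 - t) * ennreal a + ennreal t * ennreal b"
    using a b t by (simp add: c_def ennreal_mult)
  finally show ?thesis using a b m by simp
qed

section \<open>The Brunn--Minkowski inequality in the plane\<close>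

definition slice_length :: "(real \<times> real) set \<Rightarrow> real \<Rightarrow> real" where
  "slice_length S x = measure lborel (Pair x -` S)"

lemma compact_slice:
  fixes S :: "(real \<times> real) set"
  assumes "compact S" shows "compact (Pair x -` S)"
proof -
  have "Pair x -` S = snd ` (S \<inter> (fst -` {x}))" by force
  moreover have "compact (S \<inter> (fst -` {x}))"
    using assms by (intro compact_Int_closed closed_vimage_fst) auto
  ultimately show ?thesis by (simp add: compact_continuous_image continuous_on_snd)
qed

lemma emeasure_slice:
  fixes S :: "(real \<times> real) set"
  assumes "compact S" shows "emeasure lborel (Pair x -` S) = ennreal (slice_length S x)"
  unfolding slice_length_def
  using emeasure_compact_finite[OF compact_slice[OF assms, of x]]
  by (intro emeasure_eq_ennreal_measure) auto

lemma measurable_slice_length [measurable]: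
  assumes "compact S" shows "slice_length S \<in> borel_measurable borel"
proof -
  have "S \<in> sets (lborel \<Otimes>\<^sub>M lborel)"
    using borel_compact[OF assms] by (simp only: lborel_prod sets_lborel)
  then have "(\<lambda>x. emeasure lborel (Pair x -` S)) \<in> borel_measurable lborel"
    by (rule lborel.measurable_emeasure_Pair)
  then show ?thesis unfolding slice_length_def[abs_def] measure_def by simp
qed

lemma slice_length_nonneg: "0 \<le> slice_length S x"
  by (simp add: slice_length_def)

lemma slice_length_bounded:
  assumes "compact S"
  obtains B where "0 \<le> B" "\<And>x. slice_length S x \<le> B" "\<And>x. 0 < slice_length S x \<Longrightarrow> \<bar>x\<bar> \<le> B"
proof -
  obtain b where b: "b > 0" "\<And>z. z \<in> S \<Longrightarrow> norm z \<le> b"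
    using compact_imp_bounded[OF assms] by (auto simp: bounded_pos)
  have *: "\<bar>x\<bar> \<le> b \<and> \<bar>y\<bar> \<le> b" if "(x, y) \<in> S" for x y
    using b(2)[OF that] norm_fst_le[of x y] norm_snd_le[of y x] by auto
  show thesis
  proof
    show "0 \<le> 2 * b" using b by simp
    fix x
    have "slice_length S x \<le> measure lborel {-b..b}"
      unfolding slice_length_def
    proof (intro measure_mono_fmeasurable)
      show "Pair x -` S \<subseteq> {-b..b}" using * by (auto simp: abs_le_iff) fastforce
      show "Pair x -` S \<in> sets lborel" using borel_compact[OF compact_slice[OF assms]] by simp
      show "{-b..b} \<in> fmeasurable lborel" by (rule fmeasurable_compact) simp
    qed
    then show "slice_length S x \<le> 2 * b" using b by simp
    assume "0 < slice_length S x"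
    then have "Pair x -` S \<noteq> {}" by (auto simp: slice_length_def)
    then show "\<bar>x\<bar> \<le> 2 * b" using * b by fastforce
  qed
qed

text \<open>The slices are compact intervals, for which lengths add under Minkowski sums. With \<open>A = B = M\<close> this says
  that the slice length of a convex set is concave where it is positive.\<close>

lemma slice_length_mix_ge:
  fixes A B M :: "(real \<times> real) set"
  assumes A: "compact A" "convex A" and B: "compact B" "convex B" and M: "compact M"
    and mix: "\<And>z w. z \<in> A \<Longrightarrow> w \<in> B \<Longrightarrow> (1 - t) *\<^sub>R z + t *\<^sub>R w \<in> M"
    and t: "0 \<le> t" "t \<le> 1" and pos: "0 < slice_length A x" "0 < slice_length B y"
  shows "(1 - t) * slice_length A x + t * slice_length B y \<le> slice_length M ((1 - t) * x + t * y)"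
proof -
  have iv: "\<exists>a b. a \<le> b \<and> Pair x -` S = {a..b}"
    if S: "compact S" "convex S" "0 < slice_length S x" for S x
  proof -
    have "convex (Pair x -` S)"
    proof (rule convexI)
      fix y z u v :: real assume "y \<in> Pair x -` S" "z \<in> Pair x -` S" "0 \<le> u" "0 \<le> v" "u + v = 1"
      then have "u *\<^sub>R (x, y) + v *\<^sub>R (x, z) \<in> S" using S(2) by (intro convexD) auto
      moreover have "u * x + v * x = x" using \<open>u + v = 1\<close> by (simp flip: distrib_right)
      ultimately show "u *\<^sub>R y + v *\<^sub>R z \<in> Pair x -` S" by simp
    qed
    then obtain a b where "Pair x -` S = {a..b}"
      using compact_slice[OF S(1)] connected_compact_interval_1[of "Pair x -` S"] convex_connected by metis
    moreover have "Pair x -` S \<noteq> {}" using S by (auto simp: slice_length_def)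
    ultimately show ?thesis by auto
  qed
  obtain a b where ab: "a \<le> b" "Pair x -` A = {a..b}" using iv[OF A pos(1)] by blast
  obtain c d where cd: "c \<le> d" "Pair y -` B = {c..d}" using iv[OF B pos(2)] by blast
  let ?lo = "(1 - t) * a + t * c" and ?hi = "(1 - t) * b + t * d"
  have "?lo \<le> ?hi" using ab cd t by (intro add_mono mult_left_mono) auto
  have "{?lo..?hi} \<subseteq> Pair ((1 - t) * x + t * y) -` M"
  proof
    fix v assume v: "v \<in> {?lo..?hi}"
    obtain r where r: "0 \<le> r" "r \<le> 1" "v = (1 - r) * ?lo + r * ?hi"
      using v by (metis atLeastAtMost_iff closed_segment_eq_real_ivl1 \<open>?lo \<le> ?hi\<close> in_segment(1) real_scaleR_def)
    define p q where "p = a + r * (b - a)" and "q = c + r * (d - c)"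
    have "r * (b - a) \<le> 1 * (b - a)" "r * (d - c) \<le> 1 * (d - c)"
      using r ab cd by (intro mult_right_mono; simp)+
    then have "p \<in> {a..b}" "q \<in> {c..d}" using r ab cd by (auto simp: p_def q_def)
    then have "(x, p) \<in> A" "(y, q) \<in> B" using ab cd by auto
    from mix[OF this] have "((1 - t) * x + t * y, (1 - t) * p + t * q) \<in> M" by simp
    moreover have "(1 - t) * p + t * q = v" unfolding r p_def q_def by (simp add: algebra_simps)
    ultimately show "v \<in> Pair ((1 - t) * x + t * y) -` M" by simp
  qed
  then have "measure lborel {?lo..?hi} \<le> slice_length M ((1 - t) * x + t * y)"
    unfolding slice_length_def using compact_slice[OF M]
    by (intro measure_mono_fmeasurable) (auto simp: fmeasurable_compact)
  moreover have L: "slice_length A x = b - a" "slice_length B y = d - c"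
    unfolding slice_length_def ab(2) cd(2) using ab(1) cd(1) by simp_all
  have "measure lborel {?lo..?hi} = (1 - t) * slice_length A x + t * slice_length B y"
    unfolding L using \<open>?lo \<le> ?hi\<close> by (simp add: algebra_simps)
  ultimately show ?thesis by simp
qed

lemma emeasure_convex_real:
  fixes X :: "real set"
  assumes "convex X" "bounded X" "X \<noteq> {}" "X \<in> sets borel"
  shows "emeasure lborel X = ennreal (Sup X - Inf X)" "{Inf X<..<Sup X} \<subseteq> X"
proof -
  have bd: "bdd_above X" "bdd_below X"
    using assms by (simp_all add: bounded_imp_bdd_above bounded_imp_bdd_below)
  have le: "Inf X \<le> Sup X" using bd assms by (intro cInf_le_cSup) auto
  show sub: "{Inf X<..<Sup X} \<subseteq> X"
  proof
    fix v assume "v \<in> {Inf X<..<Sup X}"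
    then obtain x y where "x \<in> X" "y \<in> X" "x < v" "v < y"
      using bd assms by (auto simp: cInf_less_iff less_cSup_iff)
    then show "v \<in> X" using assms(1) by (meson interval_cases is_interval_1 is_interval_convex_1 less_imp_le)
  qed
  have "X \<subseteq> {Inf X..Sup X}" using bd by (auto intro: cInf_lower cSup_upper)
  then have "emeasure lborel X \<le> emeasure lborel {Inf X..Sup X}" by (intro emeasure_mono) auto
  moreover have "emeasure lborel {Inf X<..<Sup X} \<le> emeasure lborel X"
    using sub assms(4) by (intro emeasure_mono) auto
  ultimately show "emeasure lborel X = ennreal (Sup X - Inf X)" using le by (intro antisym) auto
qed

text \<open>The one-dimensional inequality, for convex sets that may lack their endpoints.\<close>

lemma emeasure_mix_real_ge:
  fixes X Y Z :: "real set"
  assumes X: "convex X" "bounded X" "X \<noteq> {}" "X \<in> sets borel"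
    and Y: "convex Y" "bounded Y" "Y \<noteq> {}" "Y \<in> sets borel" and Z: "Z \<in> sets borel"
    and mix: "\<And>x y. x \<in> X \<Longrightarrow> y \<in> Y \<Longrightarrow> (1 - t) * x + t * y \<in> Z" and t: "0 \<le> t" "t \<le> 1"
  shows "ennreal (1 - t) * emeasure lborel X + ennreal t * emeasure lborel Y \<le> emeasure lborel Z"
proof -
  define a b c d where "a = Inf X" and "b = Sup X" and "c = Inf Y" and "d = Sup Y"
  have bd: "bdd_above X" "bdd_below X" "bdd_above Y" "bdd_below Y"
    using X Y by (simp_all add: bounded_imp_bdd_above bounded_imp_bdd_below)
  have le: "a \<le> b" "c \<le> d"
    using bd X Y by (auto simp: a_def b_def c_def d_def intro!: cInf_le_cSup)
  have in_X: "a + r * (b - a) \<in> X" if "0 < r" "r < 1" for r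
  proof (cases "a = b")
    case True
    obtain x where "x \<in> X" using X by blast
    moreover have "a \<le> x" "x \<le> b" using bd \<open>x \<in> X\<close> by (auto simp: a_def b_def cInf_lower cSup_upper)
    ultimately show ?thesis using True by simp
  next
    case False
    then have "0 < r * (b - a)" "r * (b - a) < 1 * (b - a)" using that le by (auto intro: mult_strict_right_mono)
    then show ?thesis using emeasure_convex_real(2)[OF X] by (auto simp: a_def b_def)
  qed
  have in_Y: "c + r * (d - c) \<in> Y" if "0 < r" "r < 1" for r
  proof (cases "c = d")
    case True
    obtain y where "y \<in> Y" using Y by blast
    moreover have "c \<le> y" "y \<le> d" using bd \<open>y \<in> Y\<close> by (auto simp: c_def d_def cInf_lower cSup_upper)
    ultimately show ?thesis using True by simp
  next
    case False
    then have "0 < r * (d - c)" "r * (d - c) < 1 * (d - c)" using that le by (auto intro: mult_strict_right_mono)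
    then show ?thesis using emeasure_convex_real(2)[OF Y] by (auto simp: c_def d_def)
  qed
  let ?lo = "(1 - t) * a + t * c" and ?hi = "(1 - t) * b + t * d"
  have lh: "?lo \<le> ?hi" using le t by (intro add_mono mult_left_mono) auto
  have "{?lo<..<?hi} \<subseteq> Z"
  proof
    fix v assume v: "v \<in> {?lo<..<?hi}"
    define r where "r = (v - ?lo) / (?hi - ?lo)"
    have r: "0 < r" "r < 1" "v = ?lo + r * (?hi - ?lo)" using v by (auto simp: r_def)
    have "(1 - t) * (a + r * (b - a)) + t * (c + r * (d - c)) \<in> Z" using in_X in_Y r by (intro mix) auto
    also have "(1 - t) * (a + r * (b - a)) + t * (c + r * (d - c)) = v" unfolding r(3) by (simp add: algebra_simps)
    finally show "v \<in> Z" .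
  qed
  then have "emeasure lborel {?lo<..<?hi} \<le> emeasure lborel Z" using Z by (intro emeasure_mono) auto
  moreover have "emeasure lborel {?lo<..<?hi} = ennreal (1 - t) * ennreal (b - a) + ennreal t * ennreal (d - c)"
    using lh le t by (simp add: ennreal_mult[symmetric] ennreal_plus[symmetric] del: ennreal_plus) (simp add: algebra_simps)
  ultimately show ?thesis
    using emeasure_convex_real(1)[OF X] emeasure_convex_real(1)[OF Y] by (simp add: a_def b_def c_def d_def)
qed

text \<open>Cavalieri: the area is the area under the graph of the slice length, computed by horizontal layers. The
  heights are measured in units of \<open>F\<close>, so that two sets can later be compared layer by layer at the same relative
  height.\<close>

lemma emeasure_layer_cake:
  fixes S :: "(real \<times> real) set"
  assumes S: "compact S" and F: "0 < F"
  shows "emeasure lborel S = ennreal F * (\<integral>\<^sup>+s. indicator {0..} s * emeasure lborel {x. F * s < slice_length S x} \<partial>lborel)"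
proof -
  let ?L = "slice_length S"
  have [measurable]: "?L \<in> borel_measurable borel" using S by measurable
  have m: "(\<lambda>(x, s). indicator {0..<?L x} s :: ennreal) \<in> borel_measurable (lborel \<Otimes>\<^sub>M lborel)"
  proof -
    have "(\<lambda>(x, s). indicator {0..<?L x} s :: ennreal) = (\<lambda>p. if 0 \<le> snd p \<and> snd p < ?L (fst p) then 1 else 0)"
      by (auto simp: fun_eq_iff)
    then show ?thesis by simp
  qed
  have "emeasure lborel S = emeasure (lborel \<Otimes>\<^sub>M lborel) S" by (simp only: lborel_prod)
  also have "\<dots> = (\<integral>\<^sup>+x. emeasure lborel (Pair x -` S) \<partial>lborel)"
    using borel_compact[OF S] by (intro lborel.emeasure_pair_measure_alt) (simp only: lborel_prod sets_lborel)
  also have "\<dots> = (\<integral>\<^sup>+x. \<integral>\<^sup>+s. indicator {0..<?L x} s \<partial>lborel \<partial>lborel)"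
    by (simp add: emeasure_slice[OF S] slice_length_nonneg)
  also have "\<dots> = (\<integral>\<^sup>+s. \<integral>\<^sup>+x. indicator {0..<?L x} s \<partial>lborel \<partial>lborel)"
    by (rule lborel_pair.Fubini'[symmetric]) (rule m)
  also have "\<dots> = (\<integral>\<^sup>+s. indicator {0..} s * emeasure lborel {x. s < ?L x} \<partial>lborel)"
  proof (intro nn_integral_cong)
    fix s :: real
    have "(\<integral>\<^sup>+x. indicator {0..<?L x} s \<partial>lborel) = (\<integral>\<^sup>+x. indicator {0..} s * indicator {x. s < ?L x} x \<partial>lborel)"
      by (intro nn_integral_cong) (auto simp: indicator_def)
    also have "\<dots> = indicator {0..} s * emeasure lborel {x. s < ?L x}"
      by (simp add: nn_integral_cmult)
    finally show "(\<integral>\<^sup>+x. indicator {0..<?L x} s \<partial>lborel) = indicator {0..} s * emeasure lborel {x. s < ?L x}" .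
  qed
  also have "\<dots> = ennreal \<bar>F\<bar> * (\<integral>\<^sup>+s. indicator {0..} (0 + F * s) * emeasure lborel {x. 0 + F * s < ?L x} \<partial>lborel)"
  proof (rule nn_integral_real_affine)
    have "{p \<in> space (lborel \<Otimes>\<^sub>M lborel). fst p < ?L (snd p)} \<in> sets ((lborel::real measure) \<Otimes>\<^sub>M (lborel::real measure))"
      by measurable
    from lborel.measurable_emeasure_Pair[OF this]
    have "(\<lambda>s. emeasure lborel {x. s < ?L x}) \<in> borel_measurable borel"
      by (simp add: vimage_def space_pair_measure)
    then show "(\<lambda>s. indicator {0..} s * emeasure lborel {x. s < ?L x}) \<in> borel_measurable borel" by simp
  qed (use F in simp)
  also have "(\<lambda>s. indicator {0..} (0 + F * s) * emeasure lborel {x. 0 + F * s < ?L x})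
      = (\<lambda>s. indicator {0..} s * emeasure lborel {x. F * s < ?L x})"
    using F by (auto simp: fun_eq_iff indicator_def zero_le_mult_iff)
  finally show ?thesis using F by simp
qed

lemma exists_max_slice:
  assumes S: "compact S" and pos: "0 < emeasure lborel S"
  obtains F where "0 < F" "\<And>x. slice_length S x \<le> F" "\<And>v. v < F \<Longrightarrow> \<exists>x. v < slice_length S x"
proof -
  obtain B where B: "0 \<le> B" "\<And>x. slice_length S x \<le> B" using slice_length_bounded[OF S] by metis
  have bdd: "bdd_above (range (slice_length S))" using B by (auto simp: bdd_above_def)
  define F where "F = (SUP x. slice_length S x)"
  have up: "slice_length S x \<le> F" for x unfolding F_def using bdd by (intro cSUP_upper) auto
  have low: "\<exists>x. v < slice_length S x" if "v < F" for v
    using that bdd unfolding F_def by (subst (asm) less_cSUP_iff) auto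
  have "0 < F"
  proof (rule ccontr)
    assume "\<not> 0 < F"
    then have "{x. 1 * s < slice_length S x} = {}" if "0 \<le> s" for s
      using up that by (auto simp: not_less intro: order_trans)
    then have "(\<lambda>s. indicator {0..} s * emeasure lborel {x. 1 * s < slice_length S x}) = (\<lambda>s. 0)"
      by (auto simp: fun_eq_iff indicator_def)
    then show False using emeasure_layer_cake[OF S, of 1] pos by simp
  qed
  then show thesis using up low that by blast
qed

text \<open>Bonnesen's argument. Let \<open>F\<close> and \<open>G\<close> be the largest slice lengths of \<open>A\<close> and \<open>B\<close>, and
  \<open>H = (1 - t) F + t G\<close>. Points whose slices exceed \<open>s F\<close> in \<open>A\<close> and \<open>s G\<close> in \<open>B\<close> combine to points whose
  slice in \<open>M\<close> exceeds \<open>s H\<close>, so the one-dimensional inequality applies to the superlevel sets at equal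
  relative height \<open>s\<close>. Integrating over \<open>s\<close> yields
  \<open>area M \<ge> H ((1 - t) area A / F + t area B / G)\<close>, and \<open>H ((1 - t) / F + t / G) \<ge> 1\<close> because
  \<open>F / G + G / F \<ge> 2\<close>.\<close>

theorem brunn_minkowski_min:
  fixes A B M :: "(real \<times> real) set"
  assumes A: "compact A" "convex A" and B: "compact B" "convex B" and M: "compact M"
    and mix: "\<And>z w. z \<in> A \<Longrightarrow> w \<in> B \<Longrightarrow> (1 - t) *\<^sub>R z + t *\<^sub>R w \<in> M" and t: "0 \<le> t" "t \<le> 1"
    and c: "0 < c" "ennreal c \<le> emeasure lborel A" "ennreal c \<le> emeasure lborel B"
  shows "ennreal c \<le> emeasure lborel M"
proof -
  have "0 < emeasure lborel A" "0 < emeasure lborel B"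
    using c less_le_trans[of 0 "ennreal c"] by simp_all
  note pos = this
  obtain F where F: "0 < F" "\<And>x. slice_length A x \<le> F" "\<And>v. v < F \<Longrightarrow> \<exists>x. v < slice_length A x"
    using exists_max_slice[OF A(1) pos(1)] by blast
  obtain G where G: "0 < G" "\<And>x. slice_length B x \<le> G" "\<And>v. v < G \<Longrightarrow> \<exists>x. v < slice_length B x"
    using exists_max_slice[OF B(1) pos(2)] by blast
  define H where "H = (1 - t) * F + t * G"
  have H: "0 < H"
  proof (cases "t = 0")
    case False
    then show ?thesis unfolding H_def using F(1) G(1) t by (intro add_nonneg_pos) auto
  qed (use F(1) in \<open>simp add: H_def\<close>)
  define I where "I S F = (\<integral>\<^sup>+s. indicator {0..} s * emeasure lborel {x. F * s < slice_length S x} \<partial>lborel)" for S F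
  have level: "ennreal (1 - t) * emeasure lborel {x. F * s < slice_length A x} + ennreal t * emeasure lborel {x. G * s < slice_length B x}
      \<le> emeasure lborel {x. H * s < slice_length M x}" if s: "0 \<le> s" for s
  proof (cases "s < 1")
    case False
    then have "F * 1 \<le> F * s" "G * 1 \<le> G * s" using F G by (intro mult_left_mono; simp)+
    then have "{x. F * s < slice_length A x} = {}" "{x. G * s < slice_length B x} = {}"
      using F(2) G(2) by (auto simp: not_less intro: order_trans)
    then show ?thesis by simp
  next
    case True
    have gen: "convex {x. v < slice_length S x} \<and> bounded {x. v < slice_length S x} \<and> {x. v < slice_length S x} \<in> sets borel"
      if S: "compact S" "convex S" and v: "0 \<le> v" for S v
    proof (intro conjI)
      obtain b where "\<And>x. 0 < slice_length S x \<Longrightarrow> \<bar>x\<bar> \<le> b" using slice_length_bounded[OF S(1)] by metis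
      then show "bounded {x. v < slice_length S x}" using v by (intro boundedI[of _ b]) auto
      have [measurable]: "slice_length S \<in> borel_measurable borel" using S by measurable
      show "{x. v < slice_length S x} \<in> sets borel" by measurable
      show "convex {x. v < slice_length S x}"
        unfolding convex_alt
      proof (intro ballI allI impI)
        fix x y u assume xy: "x \<in> {x. v < slice_length S x}" "y \<in> {x. v < slice_length S x}" and u: "0 \<le> u \<and> u \<le> (1::real)"
        have "v < (1 - u) * slice_length S x + u * slice_length S y"
        proof (cases "u = 0")
          case False
          have "v = (1 - u) * v + u * v" by (simp add: algebra_simps)
          also have "\<dots> < (1 - u) * slice_length S x + u * slice_length S y"
            using xy u False by (intro add_le_less_mono mult_left_mono mult_strict_left_mono) auto
          finally show ?thesis .
        qed (use xy in auto)
        also have "\<dots> \<le> slice_length S ((1 - u) * x + u * y)"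
          using u xy v convexD_alt[OF S(2)] by (intro slice_length_mix_ge S) auto
        finally show "(1 - u) *\<^sub>R x + u *\<^sub>R y \<in> {x. v < slice_length S x}" by simp
      qed
    qed
    have Fs: "0 \<le> F * s" "F * s < F" and Gs: "0 \<le> G * s" "G * s < G" using F G s True by auto
    have [measurable]: "slice_length M \<in> borel_measurable borel" using M by measurable
    show ?thesis
    proof (rule emeasure_mix_real_ge[OF _ _ _ _ _ _ _ _ _ _ t])
      show "{x. F * s < slice_length A x} \<noteq> {}" "{x. G * s < slice_length B x} \<noteq> {}"
        using F(3)[OF Fs(2)] G(3)[OF Gs(2)] by auto
      fix x y assume xy: "x \<in> {x. F * s < slice_length A x}" "y \<in> {x. G * s < slice_length B x}"
      have "H * s = (1 - t) * (F * s) + t * (G * s)" by (simp add: H_def algebra_simps)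
      also have "\<dots> < (1 - t) * slice_length A x + t * slice_length B y"
      proof (cases "t = 0")
        case False
        then show ?thesis using xy t by (intro add_le_less_mono mult_left_mono mult_strict_left_mono) auto
      qed (use xy in auto)
      also have "\<dots> \<le> slice_length M ((1 - t) * x + t * y)"
        using xy Fs Gs by (intro slice_length_mix_ge A B M mix t) auto
      finally show "(1 - t) * x + t * y \<in> {x. H * s < slice_length M x}" by simp
    qed (use gen[OF A Fs(1)] gen[OF B Gs(1)] in auto)
  qed
  have meas: "(\<lambda>s. indicator {0..} s * emeasure lborel {x. F * s < slice_length S x}) \<in> borel_measurable lborel"
    if "compact S" for S F
  proof -
    have [measurable]: "slice_length S \<in> borel_measurable borel" using that by measurable
    have "{p \<in> space (lborel \<Otimes>\<^sub>M lborel). F * fst p < slice_length S (snd p)} \<in> sets ((lborel::real measure) \<Otimes>\<^sub>M (lborel::real measure))"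
      by measurable
    from lborel.measurable_emeasure_Pair[OF this]
    have "(\<lambda>s. emeasure lborel {x. F * s < slice_length S x}) \<in> borel_measurable borel"
      by (simp add: vimage_def space_pair_measure)
    then show ?thesis by simp
  qed
  have eqA: "emeasure lborel A = ennreal F * I A F" and eqB: "emeasure lborel B = ennreal G * I B G"
    and eqM: "emeasure lborel M = ennreal H * I M H"
    unfolding I_def
    by (rule emeasure_layer_cake[OF A(1) F(1)] emeasure_layer_cake[OF B(1) G(1)] emeasure_layer_cake[OF M H])+
  have "ennreal (1 - t) * I A F + ennreal t * I B G
     = (\<integral>\<^sup>+s. ennreal (1 - t) * (indicator {0..} s * emeasure lborel {x. F * s < slice_length A x})
        + ennreal t * (indicator {0..} s * emeasure lborel {x. G * s < slice_length B x}) \<partial>lborel)"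
    unfolding I_def using meas[OF A(1)] meas[OF B(1)]
    by (simp add: nn_integral_add nn_integral_cmult)
  also have "\<dots> \<le> I M H" unfolding I_def
    by (intro nn_integral_mono) (auto simp: indicator_def level)
  finally have IM: "ennreal (1 - t) * I A F + ennreal t * I B G \<le> I M H" .
  have IA: "ennreal (c / F) \<le> I A F" 
  proof -
    have "ennreal (c / F) = ennreal (1 / F) * ennreal c" using F c by (simp add: ennreal_mult[symmetric])
    also have "\<dots> \<le> ennreal (1 / F) * (ennreal F * I A F)" using c eqA by (intro mult_left_mono) auto
    also have "\<dots> = I A F" using F by (simp add: mult.assoc[symmetric] ennreal_mult[symmetric])
    finally show ?thesis .
  qed
  have IB: "ennreal (c / G) \<le> I B G" 
  proof -
    have "ennreal (c / G) = ennreal (1 / G) * ennreal c" using G c by (simp add: ennreal_mult[symmetric])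
    also have "\<dots> \<le> ennreal (1 / G) * (ennreal G * I B G)" using c eqB by (intro mult_left_mono) auto
    also have "\<dots> = I B G" using G by (simp add: mult.assoc[symmetric] ennreal_mult[symmetric])
    finally show ?thesis .
  qed
  have "c \<le> H * ((1 - t) * (c / F) + t * (c / G))"
  proof -
    have "2 \<le> F / G + G / F"
    proof -
      have "0 \<le> (F - G)\<^sup>2 / (F * G)" using F G by simp
      also have "(F - G)\<^sup>2 / (F * G) = F / G + G / F - 2" using F G by (simp add: field_simps power2_eq_square)
      finally show ?thesis by simp
    qed
    then have "c * (t * (1 - t)) * 2 \<le> c * (t * (1 - t)) * (F / G + G / F)"
      using c t by (intro mult_left_mono) auto
    moreover have "H * ((1 - t) * (c / F) + t * (c / G)) = c * ((1 - t)\<^sup>2 + t\<^sup>2) + c * (t * (1 - t)) * (F / G + G / F)"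
      using F G by (simp add: H_def field_simps power2_eq_square)
    moreover have "c * ((1 - t)\<^sup>2 + t\<^sup>2) + c * (t * (1 - t)) * 2 = c" by (simp add: power2_eq_square algebra_simps)
    ultimately show ?thesis by linarith
  qed
  then have "ennreal c \<le> ennreal (H * ((1 - t) * (c / F) + t * (c / G)))" by (rule ennreal_leI)
  also have "\<dots> = ennreal H * (ennreal (1 - t) * ennreal (c / F) + ennreal t * ennreal (c / G))"
    using H F G c t by (simp add: ennreal_mult[symmetric] ennreal_plus[symmetric] del: ennreal_plus times_divide_eq_right)
  also have "\<dots> \<le> ennreal H * I M H"
    by (intro mult_left_mono order_trans[OF _ IM] add_mono IA IB) auto
  finally show ?thesis using eqM by simp
qed

section \<open>Planar area\<close>

lemma area_finite: "compact S \<Longrightarrow> area S < top"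
  using emeasure_compact_finite[of S] borel_compact[of S] by (simp add: area_def)

lemma lborel_complex_eq_distr_prod:
  "(lborel :: complex measure) = distr (lborel :: (real \<times> real) measure) borel (\<lambda>p. Complex (fst p) (snd p))"
proof (rule lborel_eqI)
  let ?f = "\<lambda>p. Complex (fst p) (snd p)"
  have m: "?f \<in> borel_measurable borel"
    by (intro borel_measurable_continuous_onI) (auto simp: Complex_eq intro!: continuous_intros)
  fix l u :: complex assume le: "\<And>b. b \<in> Basis \<Longrightarrow> l \<bullet> b \<le> u \<bullet> b"
  have le': "Re l \<le> Re u" "Im l \<le> Im u" using le[of 1] le[of \<i>] by auto
  have "?f -` box l u = box (Re l, Im l) (Re u, Im u)"
    by (auto simp: box_def Basis_prod_def Basis_complex_def)
  then have "emeasure (distr lborel borel ?f) (box l u) = emeasure lborel (box (Re l, Im l) (Re u, Im u))"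
    using m by (simp add: emeasure_distr)
  also have "\<dots> = ennreal ((Re u - Re l) * (Im u - Im l))"
    using le' by (subst emeasure_lborel_box) (auto simp: Basis_prod_def prod.union_disjoint)
  also have "\<dots> = (\<Prod>b\<in>Basis. (u - l) \<bullet> b)" by (simp add: Basis_complex_def)
  finally show "emeasure (distr lborel borel ?f) (box l u) = (\<Prod>b\<in>Basis. (u - l) \<bullet> b)" .
qed simp

lemma area_eq_prod:
  assumes "compact S"
  shows "area S = emeasure lborel ((\<lambda>z. (Re z, Im z)) ` S)"
proof -
  let ?f = "\<lambda>p. Complex (fst p) (snd p)"
  have "?f \<in> borel_measurable borel"
    by (intro borel_measurable_continuous_onI) (auto simp: Complex_eq intro!: continuous_intros)
  moreover have "?f -` S = (\<lambda>z. (Re z, Im z)) ` S" by force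
  ultimately show ?thesis
    unfolding area_def using borel_compact[OF assms]
    by (simp, subst lborel_complex_eq_distr_prod) (simp add: emeasure_distr)
qed

theorem area_minkowski_mix_ge:
  fixes A B :: "complex set"
  assumes A: "compact A" "convex A" and B: "compact B" "convex B"
    and t: "0 \<le> t" "t \<le> 1" and c: "0 < c" "ennreal c \<le> area A" "ennreal c \<le> area B"
  shows "ennreal c \<le> area (minkowski_mix t A B)"
proof -
  let ?g = "\<lambda>z. (Re z, Im z)"
  have lin: "linear ?g" by (rule linearI) auto
  have cpt: "compact (?g ` S)" if "compact S" for S
    using that by (intro compact_continuous_image continuous_intros)
  have M: "compact (minkowski_mix t A B)" using A B by (intro compact_minkowski_mix)
  have "ennreal c \<le> emeasure lborel (?g ` minkowski_mix t A B)"
  proof (rule brunn_minkowski_min[of "?g ` A" "?g ` B"])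
    fix z w assume "z \<in> ?g ` A" "w \<in> ?g ` B"
    then obtain x y where "x \<in> A" "y \<in> B" "z = ?g x" "w = ?g y" by blast
    then show "(1 - t) *\<^sub>R z + t *\<^sub>R w \<in> ?g ` minkowski_mix t A B"
      using minkowski_mixI[of x A y B t] by (intro image_eqI) auto
  qed (use A B M t c lin in \<open>auto simp: cpt area_eq_prod[symmetric] intro!: convex_linear_image\<close>)
  then show ?thesis using area_eq_prod[OF M] by simp
qed

lemma lborel_complex_eq_distr_vec:
  "(lborel :: complex measure) = distr (lborel :: (real^2) measure) borel (\<lambda>v. Complex (v $ 1) (v $ 2))"
proof (rule lborel_eqI)
  let ?f = "\<lambda>v :: real^2. Complex (v $ 1) (v $ 2)"
  have m: "?f \<in> borel_measurable borel"
    by (intro borel_measurable_continuous_onI) (auto simp: Complex_eq intro!: continuous_intros)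
  fix l u :: complex assume le: "\<And>b. b \<in> Basis \<Longrightarrow> l \<bullet> b \<le> u \<bullet> b"
  have le': "Re l \<le> Re u" "Im l \<le> Im u" using le[of 1] le[of \<i>] by auto
  define L U :: "real^2" where "L = vector [Re l, Im l]" and "U = vector [Re u, Im u]"
  have "?f -` box l u = box L U"
    by (auto simp: in_box_complex_iff mem_box_cart L_def U_def forall_2)
  then have "emeasure (distr lborel borel ?f) (box l u) = emeasure lborel (box L U)"
    using m by (simp add: emeasure_distr)
  also have "\<dots> = ennreal ((Re u - Re l) * (Im u - Im l))"
    using le' by (subst emeasure_lborel_box)
      (auto simp: Basis_vec_def L_def U_def inner_axis forall_2 cart_eq_inner_axis[symmetric] axis_eq_axis prod.UNION_disjoint UNIV_2)
  also have "\<dots> = (\<Prod>b\<in>Basis. (u - l) \<bullet> b)" by (simp add: Basis_complex_def)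
  finally show "emeasure (distr lborel borel ?f) (box l u) = (\<Prod>b\<in>Basis. (u - l) \<bullet> b)" .
qed simp

text \<open>In Cartesian coordinates the rotation is an orthogonal transformation, so it preserves Lebesgue measure;
  the translation by \<open>b\<close> is treated separately.\<close>

lemma area_rotate:
  fixes S :: "complex set"
  assumes S: "compact S" and w: "norm w = 1"
  shows "area ((\<lambda>z. b + w * z) ` S) = area S"
proof -
  let ?f = "\<lambda>v :: real^2. Complex (v $ 1) (v $ 2)"
  let ?g = "\<lambda>z. vector [Re z, Im z] :: real^2"
  have gf: "?g (?f v) = v" for v by (simp add: vec_eq_iff forall_2)
  have fg: "?f (?g z) = z" for z by simp
  have m: "?f \<in> borel_measurable borel"
    by (intro borel_measurable_continuous_onI) (auto simp: Complex_eq intro!: continuous_intros)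
  have ar: "area T = emeasure lebesgue (?g ` T)" if T: "compact T" for T
  proof -
    have "?f -` T = ?g ` T"
    proof (intro equalityI subsetI)
      fix v assume "v \<in> ?f -` T"
      then show "v \<in> ?g ` T" by (intro image_eqI[of _ _ "?f v"]) (simp_all only: gf vimage_eq)
    qed auto
    moreover have gT: "?f -` T \<in> sets borel" using measurable_sets[OF m borel_compact[OF T]] by simp
    ultimately show ?thesis
      unfolding area_def using borel_compact[OF T] m
      by (simp, subst lborel_complex_eq_distr_vec) (simp add: emeasure_distr)
  qed
  have cptg: "compact (?g ` T)" if "compact T" for T
  proof -
    have "linear ?g" by (rule linearI) (auto simp: vec_eq_iff forall_2)
    then show ?thesis using that
      by (intro compact_continuous_image linear_continuous_on) (simp_all add: linear_conv_bounded_linear)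
  qed
  define R where "R v = ?g (w * ?f v)" for v
  have "orthogonal_transformation R"
    unfolding orthogonal_transformation
  proof (intro conjI allI)
    show "linear R" by (rule linearI) (auto simp: R_def vec_eq_iff forall_2 algebra_simps)
    have ng: "norm (?g z) = norm z" for z by (simp add: norm_vec_def L2_set_def UNIV_2 cmod_def)
    have nf: "norm (?f v) = norm v" for v
      using ng[of "?f v"] unfolding gf by (rule sym)
    show "norm (R v) = norm v" for v
      unfolding R_def ng norm_mult w nf by simp
  qed
  moreover have lm: "?g ` S \<in> lmeasurable" using cptg[OF S] by (rule lmeasurable_compact)
  ultimately have "measure lebesgue (R ` ?g ` S) = measure lebesgue (?g ` S)" "R ` ?g ` S \<in> lmeasurable"
    by (auto intro: measure_orthogonal_image measurable_orthogonal_image)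
  then have "emeasure lebesgue (R ` ?g ` S) = emeasure lebesgue (?g ` S)"
    using lm by (simp add: emeasure_eq_measure2)
  moreover have "R ` ?g ` S = ?g ` ((*) w ` S)" by (simp add: image_image R_def)
  moreover have "compact ((*) w ` S)" using S by (intro compact_continuous_image continuous_intros)
  ultimately have "area ((*) w ` S) = area S" using ar S by simp
  moreover have "(\<lambda>z. b + w * z) ` S = (\<lambda>x. 1 *\<^sub>R x + b) ` ((*) w ` S)" by (simp add: image_image add.commute)
  ultimately show ?thesis unfolding area_def using emeasure_lebesgue_affine[of 1 b "(*) w ` S"] by simp
qed

section \<open>Rotational symmetry and edges\<close>

definition root_rot :: "nat \<Rightarrow> complex \<Rightarrow> nat \<Rightarrow> complex \<Rightarrow> complex" where
  "root_rot k p j z = p + cis (2 * pi * real j / real k) * (z - p)"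

lemma root_rot_Suc: "k > 0 \<Longrightarrow> root_rot k p (Suc j) z = rotation k p (root_rot k p j z)"
proof -
  assume "k > 0"
  then have "2 * pi * real (Suc j) / real k = 2 * pi / real k + 2 * pi * real j / real k"
    by (simp add: field_simps)
  then show ?thesis by (simp add: root_rot_def rotation_def mult.assoc flip: cis_mult)
qed

lemma root_rot_image:
  assumes "k > 0" "symmetry_center k \<Omega> p"
  shows "root_rot k p j ` \<Omega> = \<Omega>"
proof (induction j)
  case 0
  then show ?case by (simp add: root_rot_def)
next
  case (Suc j)
  have "root_rot k p (Suc j) ` \<Omega> = rotation k p ` root_rot k p j ` \<Omega>"
    by (auto simp: root_rot_Suc[OF assms(1)] image_image)
  then show ?case using Suc assms(2) by (simp add: symmetry_center_def)
qed

lemma dist_root_rot [simp]: "dist (root_rot k p j z) (root_rot k p j w) = dist z w"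
proof -
  have "root_rot k p j z - root_rot k p j w = cis (2 * pi * real j / real k) * (z - w)"
    by (simp add: root_rot_def algebra_simps)
  then show ?thesis by (simp add: dist_norm norm_mult)
qed

lemma sum_cis_roots:
  assumes "k \<ge> 2" shows "(\<Sum>j<k. cis (2 * pi * real j / real k)) = 0"
proof -
  define w where "w = cis (2 * pi / real k)"
  have pw: "cis (2 * pi * real j / real k) = w ^ j" for j
  proof (induction j)
    case (Suc j)
    have "2 * pi * real (Suc j) / real k = 2 * pi / real k + 2 * pi * real j / real k"
      using assms by (simp add: field_simps)
    then show ?case unfolding power_Suc Suc[symmetric] by (simp only: w_def cis_mult)
  qed simp
  have "cos (2 * pi / real k) < cos 0"
    using assms by (intro cos_monotone_0_pi) (auto simp: field_simps)
  then have "w \<noteq> 1" by (auto simp: w_def complex_eq_iff)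
  moreover have "w ^ k = 1" using pw[of k] assms by simp
  ultimately show ?thesis using geometric_sum[of w k] by (simp add: pw)
qed

text \<open>The \<open>k\<close>-th roots of unity sum to zero when \<open>k \<ge> 2\<close>.\<close>

lemma avg_root_rot:
  assumes "k \<ge> 2" shows "(\<Sum>j<k. (1 / real k) *\<^sub>R root_rot k p j z) = p"
proof -
  have "(\<Sum>j<k. root_rot k p j z) = of_nat k * p + (\<Sum>j<k. cis (2 * pi * real j / real k)) * (z - p)"
    by (simp add: root_rot_def sum.distrib sum_distrib_right)
  then have "(\<Sum>j<k. root_rot k p j z) = of_nat k * p" using sum_cis_roots[OF assms] by simp
  then show ?thesis using assms unfolding scaleR_sum_right[symmetric] by (simp add: scaleR_conv_of_real)
qed

lemma interior_root_rot:
  assumes "k > 0" "symmetry_center k \<Omega> p" "z \<in> interior \<Omega>"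
  shows "root_rot k p j z \<in> interior \<Omega>"
proof -
  obtain e where e: "e > 0" "ball z e \<subseteq> \<Omega>" using assms(3) mem_interior by blast
  have "ball (root_rot k p j z) e \<subseteq> \<Omega>"
  proof
    fix y assume y: "y \<in> ball (root_rot k p j z) e"
    define c where "c = cis (2 * pi * real j / real k)"
    define y' where "y' = p + cnj c * (y - p)"
    have "c * cnj c = 1" by (simp add: c_def cis_cnj cis_mult)
    then have yy: "root_rot k p j y' = y" by (simp add: root_rot_def y'_def c_def[symmetric] mult.assoc[symmetric])
    then have "dist z y' < e" using y dist_root_rot[of k p j z y'] by simp
    then have "y' \<in> \<Omega>" using e by auto
    then show "y \<in> \<Omega>" using yy root_rot_image[OF assms(1,2), of j] by blast
  qed
  then show ?thesis using e mem_interior by blast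
qed

text \<open>The centre is the average of the rotated copies of any interior point.\<close>

lemma center_in_interior:
  assumes "k \<ge> 2" "planar_convex_body \<Omega>" "symmetry_center k \<Omega> p"
  shows "p \<in> interior \<Omega>"
proof -
  obtain z where z: "z \<in> interior \<Omega>" using assms(2) by (auto simp: planar_convex_body_def)
  have "(\<Sum>j<k. (1 / real k) *\<^sub>R root_rot k p j z) \<in> interior \<Omega>"
  proof (rule convex_sum)
    show "convex (interior \<Omega>)" using assms(2) by (simp add: planar_convex_body_def convex_interior)
    show "root_rot k p j z \<in> interior \<Omega>" for j
      using assms z by (intro interior_root_rot) auto
  qed (use assms(1) in auto)
  then show ?thesis using avg_root_rot[OF assms(1)] by simp
qed

text \<open>The smallest enclosing disk may be centred at \<open>p\<close>: if \<open>\<Omega>\<close> lies in a disk about \<open>c\<close>, averaging the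
  rotated bounds \<open>\<bar>\<theta>\<^sup>j z - c\<bar> \<le> r\<close> over \<open>j\<close> replaces \<open>c\<close> by \<open>p\<close>.\<close>

lemma subset_cball_circumradius:
  assumes k: "k \<ge> 2" and \<Omega>: "planar_convex_body \<Omega>" and sym: "symmetry_center k \<Omega> p"
  shows "\<Omega> \<subseteq> cball p (circumradius \<Omega>)"
proof
  fix z assume z: "z \<in> \<Omega>"
  have "dist p z \<le> r" if r: "\<Omega> \<subseteq> cball c r" for r c
  proof -
    define d where "d = norm (z - p)"
    define w where "w j = cis (2 * pi * real j / real k)" for j
    have nw: "norm (w j) = 1" and cw: "cnj (w j) * w j = 1" for j
      by (simp_all add: w_def cis_cnj cis_mult)
    have "(\<Sum>j<k. cnj (w j)) = cnj (\<Sum>j<k. w j)" by simp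
    also have "\<dots> = 0" using sum_cis_roots[OF k] by (simp add: w_def)
    finally have s0: "(\<Sum>j<k. cnj (w j)) = 0" .
    have "(\<Sum>j<k. cnj (w j) * (root_rot k p j z - c)) = (\<Sum>j<k. (z - p) + cnj (w j) * (p - c))"
    proof (rule sum.cong)
      fix j
      have "cnj (w j) * (root_rot k p j z - c) = (cnj (w j) * w j) * (z - p) + cnj (w j) * (p - c)"
        unfolding root_rot_def w_def[of j, symmetric] by (simp add: algebra_simps)
      then show "cnj (w j) * (root_rot k p j z - c) = (z - p) + cnj (w j) * (p - c)" by (simp add: cw)
    qed simp
    also have "\<dots> = of_nat k * (z - p)" by (simp add: sum.distrib s0 flip: sum_distrib_right)
    finally have eq: "of_nat k * (z - p) = (\<Sum>j<k. cnj (w j) * (root_rot k p j z - c))" ..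
    have "real k * norm (z - p) = norm (of_nat k * (z - p))" by (simp add: norm_mult)
    also have "\<dots> \<le> (\<Sum>j<k. norm (cnj (w j) * (root_rot k p j z - c)))" unfolding eq by (rule norm_sum)
    also have "\<dots> \<le> (\<Sum>j<k. r)"
    proof (rule sum_mono)
      fix j
      have "root_rot k p j z \<in> cball c r" using root_rot_image[OF _ sym, of j] k z r by (metis imageI not_numeral_le_zero not_gr0 subsetD)
      then show "norm (cnj (w j) * (root_rot k p j z - c)) \<le> r" by (simp add: norm_mult nw dist_norm norm_minus_commute)
    qed
    finally have "real k * norm (z - p) \<le> real k * r" by simp
    then show ?thesis using k by (simp add: dist_norm norm_minus_commute)
  qed
  moreover have "{r. 0 \<le> r \<and> (\<exists>c. \<Omega> \<subseteq> cball c r)} \<noteq> {}"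
  proof -
    have "bounded \<Omega>" using \<Omega> by (simp add: planar_convex_body_def compact_imp_bounded)
    then obtain c r where "\<Omega> \<subseteq> cball c r" using bounded_subset_cball by blast
    moreover have "0 \<le> r" using calculation z by (metis mem_cball dist_not_less_zero not_less order_trans subsetD)
    ultimately show ?thesis by blast
  qed
  ultimately have "dist p z \<le> circumradius \<Omega>"
    unfolding circumradius_def by (intro cInf_greatest) auto
  then show "z \<in> cball p (circumradius \<Omega>)" by simp
qed

lemma winding_number_circle_from:
  "winding_number (\<lambda>t. p + cis (a + 2 * pi * t)) p = 1"
proof -
  have eq: "(\<lambda>t. p + cis (a + 2 * pi * t)) = part_circlepath p 1 a (a + 2 * pi)"
    by (auto simp: part_circlepath_def linepath_def cis_conv_exp algebra_simps fun_eq_iff)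
  have m2pi_gt0: "0 < 2 * pi" by simp
  have "((\<lambda>w. 1 / (w - p)) has_contour_integral (2 * pi * \<i>)) (part_circlepath p 1 a (a + 2 * pi))"
    unfolding has_contour_integral_part_circlepath_iff[OF less_add_same_cancel1[THEN iffD2, OF m2pi_gt0]]
  proof -
    have "((\<lambda>t. \<i>) has_integral (2 * pi * \<i>)) {a..a + 2 * pi}"
      using has_integral_const_real[of \<i> a "a + 2 * pi"] by (simp add: scaleR_conv_of_real)
    then show "((\<lambda>t. 1 / (p + complex_of_real 1 * cis t - p) * complex_of_real 1 * \<i> * cis t) has_integral complex_of_real (2 * pi) * \<i>) {a..a + 2 * pi}"
      by simp
  qed
  then have "contour_integral (part_circlepath p 1 a (a + 2 * pi)) (\<lambda>w. 1 / (w - p)) = 2 * pi * \<i>"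
    by (rule contour_integral_unique)
  moreover have "p \<notin> path_image (part_circlepath p 1 a (a + 2 * pi))"
    unfolding eq[symmetric] path_image_def by auto
  ultimately show ?thesis unfolding eq by (subst winding_number_valid_path) auto
qed

text \<open>The boundary traversed by polar angle about \<open>p\<close>, starting in direction \<open>cis a\<close>. Pushing it radially onto
  the unit circle about \<open>p\<close> is a homotopy that avoids \<open>p\<close>, so the winding number is that of the circle.\<close>

lemma radial_ccw_boundary_path:
  assumes \<Omega>: "planar_convex_body \<Omega>" and p: "p \<in> interior \<Omega>"
  obtains g where "ccw_boundary_path \<Omega> g"
    "\<And>t r. 0 \<le> r \<Longrightarrow> p + r *\<^sub>R cis (a + 2 * pi * t) \<in> frontier \<Omega> \<Longrightarrow> g t = p + r *\<^sub>R cis (a + 2 * pi * t)"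
proof -
  have K: "compact \<Omega>" "convex \<Omega>" using \<Omega> by (auto simp: planar_convex_body_def)
  obtain \<Gamma> where \<Gamma>: "continuous_on (sphere 0 1) \<Gamma>" "\<Gamma> ` sphere 0 1 = frontier \<Omega>"
    "\<And>u. u \<in> sphere 0 1 \<Longrightarrow> \<exists>r>0. \<Gamma> u = p + r *\<^sub>R u"
    "\<And>u r. u \<in> sphere 0 1 \<Longrightarrow> 0 \<le> r \<Longrightarrow> p + r *\<^sub>R u \<in> frontier \<Omega> \<Longrightarrow> \<Gamma> u = p + r *\<^sub>R u"
    using radial_parametrization[OF K p] by metis
  define e where "e t = cis (a + 2 * pi * t)" for t
  define g where "g t = \<Gamma> (e t)" for t
  have es: "e t \<in> sphere 0 1" for t by (simp add: e_def)
  have ray: "\<exists>r>0. g t = p + r *\<^sub>R e t" for t using \<Gamma>(3)[OF es] by (simp add: g_def)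
  have pathg: "path g"
    unfolding path_def g_def
    by (rule continuous_on_compose2[OF \<Gamma>(1)]) (auto simp: e_def intro!: continuous_intros)
  have e01: "e 0 = e 1" by (simp add: e_def flip: cis_mult)
  have closed: "pathfinish g = pathstart g" by (simp add: pathfinish_def pathstart_def g_def e01)
  have free: "loop_free g"
    unfolding loop_free_def
  proof (intro ballI impI)
    fix x y :: real assume xy: "x \<in> {0..1}" "y \<in> {0..1}" "g x = g y"
    obtain r s where rs: "r > 0" "s > 0" "g x = p + r *\<^sub>R e x" "g y = p + s *\<^sub>R e y" using ray by metis
    then have eq: "r *\<^sub>R e x = s *\<^sub>R e y" using xy by simp
    then have "norm (r *\<^sub>R e x) = norm (s *\<^sub>R e y)" by simp
    then have "r = s" using rs by (simp add: e_def)
    then have "cis (a + 2 * pi * x) = cis (a + 2 * pi * y)" using eq rs by (simp add: e_def)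
    then obtain n :: int where "a + 2 * pi * x = a + 2 * pi * y + 2 * pi * n" by (rule cis_eq_imp_int_multiple)
    then have "2 * pi * x = 2 * pi * (y + n)" by (simp add: algebra_simps)
    then have n: "x = y + n" by simp
    then have "\<bar>real_of_int n\<bar> \<le> 1" using xy by auto
    then have "n = 0 \<or> n = 1 \<or> n = -1" by linarith
    then show "x = y \<or> x = 0 \<and> y = 1 \<or> x = 1 \<and> y = 0" using n xy by auto
  qed
  have img: "path_image g = frontier \<Omega>"
  proof -
    have "e ` {0..1} = sphere 0 1"
    proof
      show "e ` {0..1} \<subseteq> sphere 0 1" using es by blast
      show "sphere 0 1 \<subseteq> e ` {0..1}"
      proof
        fix u :: complex assume u: "u \<in> sphere 0 1"
        define t where "t = frac ((Arg u - a) / (2 * pi))"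
        have "a + 2 * pi * t = Arg u + 2 * pi * real_of_int (- \<lfloor>(Arg u - a) / (2 * pi)\<rfloor>)"
          by (simp add: t_def frac_def field_simps)
        then have "e t = cis (Arg u) * cis (2 * pi * real_of_int (- \<lfloor>(Arg u - a) / (2 * pi)\<rfloor>))"
          unfolding e_def cis_mult by simp
        also have "cis (2 * pi * real_of_int (- \<lfloor>(Arg u - a) / (2 * pi)\<rfloor>)) = 1"
          by (rule cis_multiple_2pi) simp
        also have "cis (Arg u) * 1 = u"
        proof -
          have "u \<noteq> 0" using u by auto
          then show ?thesis using u cis_Arg[of u] by (simp add: sgn_div_norm)
        qed
        finally show "u \<in> e ` {0..1}"
          by (intro image_eqI[of _ _ t]) (auto simp: t_def frac_ge_0 frac_lt_1 less_imp_le)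
      qed
    qed
    then show ?thesis unfolding path_image_def g_def using \<Gamma>(2) by (metis image_image)
  qed
  have pn: "p \<notin> frontier \<Omega>" using p by (simp add: frontier_def)
  have wp: "winding_number g p = 1"
  proof -
    let ?c = "\<lambda>t. p + e t"
    have "homotopic_loops (- {p}) g ?c"
    proof (rule homotopic_loops_linear)
      show "path ?c" unfolding path_def e_def by (intro continuous_intros)
      show "pathfinish ?c = pathstart ?c" by (simp add: pathfinish_def pathstart_def e01)
      show "closed_segment (g t) (?c t) \<subseteq> - {p}" for t
      proof -
        obtain r where r: "r > 0" "g t = p + r *\<^sub>R e t" using ray by blast
        have "p \<noteq> (1 - u) *\<^sub>R g t + u *\<^sub>R (p + e t)" if "0 \<le> u" "u \<le> 1" for u
        proof
          assume "p = (1 - u) *\<^sub>R g t + u *\<^sub>R (p + e t)"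
          also have "\<dots> = p + ((1 - u) * r + u) *\<^sub>R e t" unfolding r by (simp add: algebra_simps)
          finally have "((1 - u) * r + u) *\<^sub>R e t = 0" by simp
          then have "(1 - u) * r + u = 0" by (simp add: e_def)
          moreover have "0 \<le> (1 - u) * r" using that r by simp
          ultimately have "u = 0" "(1 - u) * r = 0" using that by linarith+
          then show False using r by simp
        qed
        then show ?thesis by (auto simp: closed_segment_def)
      qed
    qed (use pathg closed in auto)
    then have "winding_number g p = winding_number ?c p" by (rule winding_number_homotopic_loops)
    then show ?thesis using winding_number_circle_from[of p a] by (simp add: e_def)
  qed
  have "winding_number g w = 1" if "w \<in> interior \<Omega>" for w
  proof -
    have "interior \<Omega> \<inter> path_image g = {}" unfolding img by (auto simp: frontier_def)
    then have "winding_number g w = winding_number g p"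
      using K by (intro winding_number_eq[OF pathg closed that p] convex_connected convex_interior)
    then show ?thesis using wp by simp
  qed
  then have "ccw_boundary_path \<Omega> g"
    unfolding ccw_boundary_path_def simple_path_def using pathg free closed img by blast
  moreover have "g t = p + r *\<^sub>R cis (a + 2 * pi * t)" if "0 \<le> r" "p + r *\<^sub>R cis (a + 2 * pi * t) \<in> frontier \<Omega>" for t r
    using \<Gamma>(4)[OF es[of t] that(1)] that(2) by (simp add: g_def e_def)
  ultimately show thesis using that by blast
qed

text \<open>Boundary points are passed in the order of their polar angles, so the arc between two boundary points
  contains the boundary part of the sector that they span.\<close>

lemma sector_in_ccw_arc:
  assumes \<Omega>: "planar_convex_body \<Omega>" and p: "p \<in> interior \<Omega>"
    and x: "p + R *\<^sub>R cis a \<in> frontier \<Omega>" "p + R' *\<^sub>R cis (a + b) \<in> frontier \<Omega>" "0 \<le> R" "0 \<le> R'"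
    and z: "p + r *\<^sub>R cis (a + s) \<in> frontier \<Omega>" "0 \<le> r" and s: "0 \<le> s" "s \<le> b" "b \<le> 2 * pi"
  shows "p + r *\<^sub>R cis (a + s) \<in> ccw_arc \<Omega> (p + R *\<^sub>R cis a) (p + R' *\<^sub>R cis (a + b))"
proof -
  obtain g where g: "ccw_boundary_path \<Omega> g"
    "\<And>t r. 0 \<le> r \<Longrightarrow> p + r *\<^sub>R cis (a + 2 * pi * t) \<in> frontier \<Omega> \<Longrightarrow> g t = p + r *\<^sub>R cis (a + 2 * pi * t)"
    using radial_ccw_boundary_path[OF \<Omega> p, of a] by metis
  have "pathstart g = p + R *\<^sub>R cis a" using g(2)[of R 0] x by (simp add: pathstart_def)
  moreover have "g (b / (2 * pi)) = p + R' *\<^sub>R cis (a + b)" using g(2)[of R' "b / (2 * pi)"] x by simp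
  moreover have "p + r *\<^sub>R cis (a + s) = g (s / (2 * pi))" using g(2)[of r "s / (2 * pi)"] z by simp
  moreover have "s / (2 * pi) \<in> {0..b / (2 * pi)}" "b / (2 * pi) \<in> {0..1}" using s by (auto simp: divide_right_mono)
  ultimately show ?thesis unfolding ccw_arc_def using g(1) by blast
qed

section \<open>Symmetrization and optimality\<close>

text \<open>For unimodular \<open>w\<close> this is invariance under rotation, for real \<open>w > 1\<close> it is the scaling of a dilation.\<close>

lemma perimeter_similarity_le:
  fixes S :: "complex set"
  assumes "compact S" "w \<noteq> 0"
  shows "perimeter ((\<lambda>z. b + w * z) ` S) \<le> ennreal (norm w) * perimeter S"
proof -
  let ?f = "\<lambda>z. b + w * z"
  have d: "dist (?f x) (?f y) = norm w * dist x y" for x y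
    by (simp add: dist_norm norm_mult[symmetric] algebra_simps)
  have "frontier (?f ` S) \<subseteq> ?f ` frontier S"
  proof
    fix y assume y: "y \<in> frontier (?f ` S)"
    have "compact (?f ` S)" using assms by (intro compact_continuous_image continuous_intros)
    then have "y \<in> ?f ` S" using y by (auto simp: frontier_def dest: compact_imp_closed)
    then obtain z where z: "z \<in> S" "y = ?f z" by blast
    have "z \<notin> interior S"
    proof
      assume "z \<in> interior S"
      then obtain e where e: "e > 0" "ball z e \<subseteq> S" using mem_interior by blast
      have "ball y (norm w * e) \<subseteq> ?f ` S"
      proof
        fix v assume v: "v \<in> ball y (norm w * e)"
        define u where "u = (v - b) / w"
        have vu: "v = ?f u" using assms by (simp add: u_def)
        then have "norm w * dist z u < norm w * e" using v d[of z u] z by simp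
        then have "u \<in> S" using e assms by auto
        then show "v \<in> ?f ` S" using vu by blast
      qed
      then have "y \<in> interior (?f ` S)" using e assms by (auto simp: mem_interior intro!: exI[of _ "norm w * e"])
      then show False using y by (simp add: frontier_def)
    qed
    then show "y \<in> ?f ` frontier S" using z closure_subset by (auto simp: frontier_def)
  qed
  then have "perimeter (?f ` S) \<le> hausdorff1 (?f ` frontier S)"
    unfolding perimeter_def by (rule hausdorff1_mono)
  also have "\<dots> \<le> ennreal (norm w) * perimeter S"
    unfolding perimeter_def using d assms by (intro hausdorff1_lipschitz_image_le) auto
  finally show ?thesis .
qed

text \<open>The average of \<open>A 0, \<dots>, A m\<close>, built one summand at a time so that two-set inequalities can be iterated.\<close>

primrec minkowski_average :: "(nat \<Rightarrow> 'a::real_vector set) \<Rightarrow> nat \<Rightarrow> 'a set" where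
  "minkowski_average A 0 = A 0"
| "minkowski_average A (Suc m) = minkowski_mix (1 / real (m + 2)) (minkowski_average A m) (A (Suc m))"

lemma minkowski_averageE:
  assumes "z \<in> minkowski_average A m"
  obtains c where "\<And>j. j \<le> m \<Longrightarrow> c j \<in> A j" "z = (1 / real (Suc m)) *\<^sub>R (\<Sum>j\<le>m. c j)"
  using assms
proof (induction m arbitrary: z thesis)
  case 0
  then show ?case by (intro "0.prems"(1)[of "\<lambda>_. z"]) auto
next
  case (Suc m)
  define t where "t = 1 / real (m + 2)"
  obtain x y where xy: "x \<in> minkowski_average A m" "y \<in> A (Suc m)" "z = (1 - t) *\<^sub>R x + t *\<^sub>R y"
    using Suc.prems(2) by (auto simp: minkowski_mix_def t_def)
  obtain c where c: "\<And>j. j \<le> m \<Longrightarrow> c j \<in> A j" "x = (1 / real (Suc m)) *\<^sub>R (\<Sum>j\<le>m. c j)"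
    using Suc.IH[OF _ xy(1)] by metis
  let ?c = "c(Suc m := y)"
  have "(1 - t) * (1 / real (Suc m)) = t" by (simp add: t_def field_simps)
  then have "z = t *\<^sub>R (\<Sum>j\<le>m. c j) + t *\<^sub>R y" unfolding xy(3) c(2) scaleR_scaleR by simp
  also have "\<dots> = (1 / real (Suc (Suc m))) *\<^sub>R (\<Sum>j\<le>Suc m. ?c j)"
    by (simp add: t_def scaleR_add_right)
  finally show ?case using c xy by (intro Suc.prems(1)[of ?c]) (auto simp: le_Suc_eq)
qed

lemma minkowski_average_convex_body:
  fixes A :: "nat \<Rightarrow> complex set"
  assumes A: "\<And>j. compact (A j)" "\<And>j. convex (A j)" "\<And>j. interior (A j) \<noteq> {}"
    and P: "\<And>j. perimeter (A j) \<le> P" and c: "0 < c" "\<And>j. ennreal c \<le> area (A j)"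
  shows "compact (minkowski_average A m)" "convex (minkowski_average A m)" "interior (minkowski_average A m) \<noteq> {}"
    "perimeter (minkowski_average A m) \<le> P" "ennreal c \<le> area (minkowski_average A m)"
proof -
  have "compact (minkowski_average A m) \<and> convex (minkowski_average A m) \<and> interior (minkowski_average A m) \<noteq> {}
     \<and> perimeter (minkowski_average A m) \<le> P \<and> ennreal c \<le> area (minkowski_average A m)"
  proof (induction m)
    case 0
    then show ?case using assms by simp
  next
    case (Suc m)
    define t where "t = 1 / real (m + 2)"
    have t: "0 \<le> t" "t \<le> 1" by (auto simp: t_def)
    let ?X = "minkowski_average A m" and ?Y = "A (Suc m)"
    have "perimeter (minkowski_mix t ?X ?Y) \<le> ennreal (1 - t) * perimeter ?X + ennreal t * perimeter ?Y"
      using Suc A t by (intro perimeter_minkowski_mix_le) auto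
    also have "\<dots> \<le> ennreal (1 - t) * P + ennreal t * P"
      using Suc P by (intro add_mono mult_left_mono) auto
    also have "\<dots> = P" using t by (simp flip: distrib_right ennreal_plus)
    finally have "perimeter (minkowski_mix t ?X ?Y) \<le> P" .
    moreover have "ennreal c \<le> area (minkowski_mix t ?X ?Y)"
      using Suc A t c by (intro area_minkowski_mix_ge) auto
    ultimately show ?case using Suc A
      by (simp add: t_def compact_minkowski_mix convex_minkowski_mix interior_minkowski_mix)
  qed
  then show "compact (minkowski_average A m)" "convex (minkowski_average A m)" "interior (minkowski_average A m) \<noteq> {}"
    "perimeter (minkowski_average A m) \<le> P" "ennreal c \<le> area (minkowski_average A m)" by blast+
qed

lemma minkowski_average_subset:
  assumes "convex S" "\<And>j. A j \<subseteq> S" shows "minkowski_average A m \<subseteq> S"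
proof (induction m)
  case (Suc m)
  have "(1 - 1 / real (m + 2)) *\<^sub>R x + (1 / real (m + 2)) *\<^sub>R y \<in> S" if "x \<in> S" "y \<in> S" for x y
    using that by (intro convexD_alt assms) auto
  then show ?case using Suc assms(2)[of "Suc m"] by (auto simp: minkowski_mix_def)
qed (use assms in simp)

lemma dilation_in_interior:
  fixes M :: "complex set"
  assumes "compact M" "M \<subseteq> interior \<Omega>"
  obtains t where "0 < t" "(\<lambda>z. 0 + of_real (1 + t) * z) ` M \<subseteq> \<Omega>"
proof -
  obtain e where e: "e > 0" "(\<Union>x\<in>M. ball x e) \<subseteq> interior \<Omega>"
    using compact_subset_open_imp_ball_epsilon_subset[OF assms(1) open_interior assms(2)] by blast
  obtain B where B: "B > 0" "\<And>z. z \<in> M \<Longrightarrow> norm z \<le> B"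
    using compact_imp_bounded[OF assms(1)] by (auto simp: bounded_pos)
  define t where "t = e / (2 * B)"
  have t: "0 < t" using e B by (simp add: t_def)
  have "0 + of_real (1 + t) * z \<in> \<Omega>" if z: "z \<in> M" for z
  proof -
    have "z - (0 + of_real (1 + t) * z) = - (of_real t * z)" by (simp add: algebra_simps)
    then have "dist z (0 + of_real (1 + t) * z) = t * norm z" using t by (simp add: dist_norm norm_mult)
    also have "\<dots> \<le> t * B" using B(2)[OF z] t by (intro mult_left_mono) auto
    also have "\<dots> < e" using e B by (simp add: t_def)
    finally have "0 + of_real (1 + t) * z \<in> ball z e" by simp
    then show ?thesis using e z interior_subset by blast
  qed
  then show thesis using that t by blast
qed

lemma area_dilation:
  assumes "0 \<le> s" shows "area ((\<lambda>z. 0 + of_real s * z) ` S) = ennreal (s\<^sup>2) * area S"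
proof -
  have "(\<lambda>z. 0 + of_real s * z) ` S = (\<lambda>x. s *\<^sub>R x + 0) ` S" by (simp add: scaleR_conv_of_real)
  then show ?thesis unfolding area_def using emeasure_lebesgue_affine[of s 0 S] assms
    by (simp add: ennreal_power)
qed

text \<open>A body inside the interior can be dilated by a factor \<open>1 + t\<close>. Its perimeter grows by this factor, its
  area by the square of it, so its ratio would drop strictly below the Cheeger constant, which is positive and
  finite because \<open>C\<close> has positive finite perimeter and area.\<close>

lemma optimal_body_meets_frontier:
  fixes C M \<Omega> :: "complex set"
  assumes \<Omega>: "compact \<Omega>" and C: "compact C" "convex C" "interior C \<noteq> {}" "is_cheeger_set \<Omega> C"
    and M: "compact M" "M \<subseteq> \<Omega>" "perimeter M \<le> perimeter C" "area C \<le> area M"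
  shows "M \<inter> frontier \<Omega> \<noteq> {}"
proof
  assume "M \<inter> frontier \<Omega> = {}"
  then have "M \<subseteq> interior \<Omega>" using M closure_subset[of \<Omega>] by (auto simp: frontier_def)
  then obtain t where t: "0 < t" "(\<lambda>z. 0 + of_real (1 + t) * z) ` M \<subseteq> \<Omega>"
    using dilation_in_interior[OF M(1)] by blast
  define X where "X = (\<lambda>z. 0 + complex_of_real (1 + t) * z) ` M"
  obtain q where q: "0 < q" "perimeter C = ennreal q"
    using perimeter_finite[OF C(1-3)] perimeter_pos[OF C(1-3)]
    by (metis ennreal_cases ennreal_less_zero_iff less_irrefl)
  obtain c where c: "0 < c" "area C = ennreal c"
    using area_finite[OF C(1)] C(4) unfolding is_cheeger_set_def
    by (metis ennreal_cases ennreal_less_zero_iff less_irrefl)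
  obtain m where m: "0 \<le> m" "area M = ennreal m" using area_finite[OF M(1)] by (metis ennreal_cases less_irrefl)
  have cm: "c \<le> m" using M(4) c m by simp
  have aX: "area X = ennreal ((1 + t)\<^sup>2 * m)"
    unfolding X_def using t m by (subst area_dilation) (auto simp: ennreal_mult)
  have "perimeter X \<le> ennreal (norm (complex_of_real (1 + t))) * perimeter M"
    unfolding X_def using t by (intro perimeter_similarity_le M(1)) (simp del: of_real_add)
  also have "\<dots> \<le> ennreal (1 + t) * perimeter C" using t M(3) by (intro mult_mono) (auto simp del: of_real_add)
  also have "\<dots> = ennreal ((1 + t) * q)" using t q by (simp add: ennreal_mult)
  finally have pX: "perimeter X \<le> ennreal ((1 + t) * q)" .
  have mpos: "0 < (1 + t)\<^sup>2 * m" using t c cm by simp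
  have "compact X" unfolding X_def using M(1) by (intro compact_continuous_image continuous_intros)
  then have "X \<in> {X. X \<in> sets lebesgue \<and> X \<subseteq> \<Omega> \<and> area X > 0}"
    using t aX mpos borel_compact[of X] by (auto simp: X_def)
  then have "cheeger_constant \<Omega> \<le> perimeter X / area X"
    unfolding cheeger_constant_def by (rule INF_lower)
  also have "\<dots> \<le> ennreal ((1 + t) * q) / ennreal ((1 + t)\<^sup>2 * m)"
    unfolding aX by (intro divide_right_mono_ennreal pX)
  also have "\<dots> = ennreal (((1 + t) * q) / ((1 + t)\<^sup>2 * m))"
    using t q mpos by (intro divide_ennreal) auto
  also have "((1 + t) * q) / ((1 + t)\<^sup>2 * m) = q / ((1 + t) * m)"
    using t by (simp add: power2_eq_square)
  finally have le: "cheeger_constant \<Omega> \<le> ennreal (q / ((1 + t) * m))" .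
  have "cheeger_constant \<Omega> = ennreal (q / c)"
    using C(4) q c unfolding is_cheeger_set_def by (simp add: divide_ennreal)
  then have "q / c \<le> q / ((1 + t) * m)" using le q t c cm by simp
  moreover have "q / ((1 + t) * m) < q / c"
  proof (rule divide_strict_left_mono)
    have "c < (1 + t) * c" using t c by simp
    also have "\<dots> \<le> (1 + t) * m" using t cm by simp
    finally show "c < (1 + t) * m" .
  qed (use q c t cm in auto)
  ultimately show False by simp
qed

text \<open>The points of \<open>\<Omega>\<close> on the supporting line at \<open>m\<close> stay in the sector of \<open>m\<close> between two consecutive
  dots, provided \<open>m\<close> is closer to \<open>p\<close> than the dots are. Angles measured from the normal turn the distances from
  \<open>p\<close> to \<open>m\<close> and \<open>q\<close> into \<open>h / cos \<mu>\<close> and \<open>h / cos \<beta>\<close>, with \<open>h\<close> the distance from \<open>p\<close> to the line.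
  A dot in a direction \<open>\<gamma>\<close> between them has \<open>cos \<gamma> > cos \<beta>\<close> or \<open>cos \<gamma> \<ge> cos \<mu>\<close>; as its distance
  \<open>R\<close> from \<open>p\<close> is at least that of \<open>q\<close> and larger than that of \<open>m\<close>, it would lie beyond the line.\<close>

lemma face_in_sector:
  fixes p m q n :: complex
  assumes ball: "\<Omega> \<subseteq> cball p R"
    and u: "p + R *\<^sub>R cis a \<in> \<Omega>" "p + R *\<^sub>R cis (a + b) \<in> \<Omega>"
    and m: "m = p + r *\<^sub>R cis (a + s)" "0 \<le> r" "r < R" "0 \<le> s" "s \<le> b"
    and q: "q \<in> \<Omega>" "q \<bullet> n = m \<bullet> n"
    and sup: "\<And>x. x \<in> \<Omega> \<Longrightarrow> x \<bullet> n \<le> m \<bullet> n" and p: "p \<bullet> n < m \<bullet> n"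
  obtains r' s' where "0 \<le> r'" "0 \<le> s'" "s' \<le> b" "q = p + r' *\<^sub>R cis (a + s')"
proof -
  define H where "H = (m - p) \<bullet> n"
  have H: "0 < H" "(q - p) \<bullet> n = H" using p q by (auto simp: H_def inner_diff_left)
  have n0: "n \<noteq> 0" using H by (auto simp: H_def)
  define \<mu> where "\<mu> = Arg ((m - p) * cnj n)"
  define \<beta> where "\<beta> = Arg ((q - p) * cnj n)"
  define \<rho> where "\<rho> = norm (q - p)"
  have bd: "\<bar>\<mu>\<bar> < pi / 2" "\<bar>\<beta>\<bar> < pi / 2" 
    using abs_Arg_less_pi_half[of "m - p" n] abs_Arg_less_pi_half[of "q - p" n] H by (auto simp: \<mu>_def \<beta>_def H_def)
  define \<nu> where "\<nu> = a + s - \<mu>"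
  have rpos: "0 < r" using m H by (cases "r = 0") (auto simp: H_def)
  have n: "n = norm n *\<^sub>R cis \<nu>"
  proof -
    have "(m - p) * cnj n = norm ((m - p) * cnj n) *\<^sub>R cis \<mu>" unfolding \<mu>_def by (rule polar_form)
    then have "r *\<^sub>R (cis (a + s) * cnj n) = (r * norm n) *\<^sub>R cis \<mu>" using m by (simp add: norm_mult)
    then have "cis (a + s) * cnj n = norm n *\<^sub>R cis \<mu>" using rpos by (simp flip: scaleR_scaleR)
    then have "cis (- (a + s)) * (cis (a + s) * cnj n) = cis (- (a + s)) * (norm n *\<^sub>R cis \<mu>)" by (rule arg_cong)
    moreover have "cis (- (a + s)) * (cis (a + s) * cnj n) = cnj n"
      by (simp only: mult.assoc[symmetric] cis_mult) simp
    moreover have "cis (- (a + s)) * (norm n *\<^sub>R cis \<mu>) = norm n *\<^sub>R cis (\<mu> - (a + s))"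
      by (simp add: cis_mult del: minus_add_distrib)
    ultimately have "cnj n = norm n *\<^sub>R cis (\<mu> - (a + s))" by metis
    then have "cnj (cnj n) = cnj (norm n *\<^sub>R cis (\<mu> - (a + s)))" by (rule arg_cong)
    then show ?thesis by (simp add: \<nu>_def cis_cnj)
  qed
  have qp: "q - p = \<rho> *\<^sub>R cis (\<nu> + \<beta>)"
  proof -
    have "(q - p) * cnj n = (\<rho> * norm n) *\<^sub>R cis \<beta>"
      unfolding \<beta>_def \<rho>_def using polar_form[of "(q - p) * cnj n"] by (simp add: norm_mult)
    then have "(q - p) * cnj n * n = (\<rho> * norm n) *\<^sub>R cis \<beta> * n" by (rule arg_cong)
    also have "(\<rho> * norm n) *\<^sub>R cis \<beta> * n = (norm n * norm n) *\<^sub>R (\<rho> *\<^sub>R cis (\<nu> + \<beta>))"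
      by (subst (2) n) (simp add: cis_mult add.commute)
    also have "(q - p) * cnj n * n = (norm n * norm n) *\<^sub>R (q - p)"
      by (simp add: scaleR_conv_of_real mult.assoc complex_norm_square[symmetric] power2_eq_square mult.commute[of "cnj n"])
    finally have "(norm n * norm n) *\<^sub>R (q - p) = (norm n * norm n) *\<^sub>R (\<rho> *\<^sub>R cis (\<nu> + \<beta>))" .
    then show ?thesis using n0 by (simp only: scaleR_cancel_left mult_eq_0_iff norm_eq_zero simp_thms)
  qed
  have inner: "(x *\<^sub>R cis (\<nu> + \<gamma>)) \<bullet> n = norm n * (x * cos \<gamma>)" for x \<gamma>
  proof -
    have "(x *\<^sub>R cis (\<nu> + \<gamma>)) \<bullet> n = (x *\<^sub>R cis (\<nu> + \<gamma>)) \<bullet> (norm n *\<^sub>R cis \<nu>)" using n by simp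
    also have "\<dots> = norm n * x * cos ((\<nu> + \<gamma>) - \<nu>)" unfolding cos_diff by (simp add: inner_complex_def algebra_simps)
    finally show ?thesis by simp
  qed
  define h where "h = H / norm n"
  have mh: "r * cos \<mu> = h"
  proof -
    have "m - p = r *\<^sub>R cis (\<nu> + \<mu>)" using m by (simp add: \<nu>_def)
    then have "H = norm n * (r * cos \<mu>)" unfolding H_def by (simp only: inner)
    then show ?thesis using n0 by (simp add: h_def)
  qed
  have qh: "\<rho> * cos \<beta> = h"
    using H(2) n0 unfolding qp inner by (simp add: h_def field_simps)
  have uh: "R * cos \<gamma> \<le> h" if "p + R *\<^sub>R cis (\<nu> + \<gamma>) \<in> \<Omega>" for \<gamma>
  proof -
    have "(R *\<^sub>R cis (\<nu> + \<gamma>)) \<bullet> n \<le> H" using sup[OF that] by (simp add: H_def inner_add_left inner_diff_left)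
    then show ?thesis unfolding inner using n0 by (simp add: h_def field_simps)
  qed
  have \<rho>: "0 \<le> \<rho>" "\<rho> \<le> R" using ball q by (auto simp: \<rho>_def dist_norm norm_minus_commute)
  have R: "0 < R" using m by linarith
  have cpos: "0 < cos \<mu>" "0 < cos \<beta>" using bd by (auto intro!: cos_gt_zero_pi)
  \<comment> \<open>No dot lies in a direction from \<open>\<mu>\<close>, inclusive, to \<open>\<beta>\<close>, exclusive.\<close>
  have no: False if g: "p + R *\<^sub>R cis (\<nu> + \<gamma>) \<in> \<Omega>" and "\<mu> \<le> \<gamma> \<and> \<gamma> < \<beta> \<or> \<beta> < \<gamma> \<and> \<gamma> \<le> \<mu>" for \<gamma>
  proof -
    have "cos \<beta> < cos \<gamma> \<or> cos \<mu> \<le> cos \<gamma>"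
      using that(2)
    proof
      assume *: "\<mu> \<le> \<gamma> \<and> \<gamma> < \<beta>"
      show ?thesis
      proof (cases "0 \<le> \<gamma>")
        case True
        then show ?thesis using * bd by (auto intro!: cos_monotone_0_pi)
      next
        case False
        then have "cos (- \<mu>) \<le> cos (- \<gamma>)" using * bd by (intro cos_monotone_0_pi_le) linarith+
        then show ?thesis by simp
      qed
    next
      assume *: "\<beta> < \<gamma> \<and> \<gamma> \<le> \<mu>"
      show ?thesis
      proof (cases "0 \<le> \<gamma>")
        case True
        then show ?thesis using * bd by (auto intro!: cos_monotone_0_pi_le)
      next
        case False
        then have "cos (- \<beta>) < cos (- \<gamma>)" using * bd by (intro cos_monotone_0_pi) linarith+
        then show ?thesis by simp
      qed
    qed
    then show False
    proof
      assume "cos \<beta> < cos \<gamma>"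
      then have "R * cos \<beta> < R * cos \<gamma>" using R by simp
      moreover have "\<rho> * cos \<beta> \<le> R * cos \<beta>" using \<rho> cpos by simp
      ultimately show False using uh[OF g] qh by linarith
    next
      assume "cos \<mu> \<le> cos \<gamma>"
      then have "R * cos \<mu> \<le> R * cos \<gamma>" using R by simp
      moreover have "r * cos \<mu> < R * cos \<mu>" using m cpos by simp
      ultimately show False using uh[OF g] mh by linarith
    qed
  qed
  define s' where "s' = s + \<beta> - \<mu>"
  have "s' \<le> b"
  proof (rule ccontr)
    assume "\<not> s' \<le> b"
    then show False using no[of "\<mu> + (b - s)"] u m by (auto simp: s'_def \<nu>_def algebra_simps)
  qed
  moreover have "0 \<le> s'"
  proof (rule ccontr)
    assume "\<not> 0 \<le> s'"
    then show False using no[of "\<mu> - s"] u m by (auto simp: s'_def \<nu>_def)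
  qed
  moreover have "q = p + \<rho> *\<^sub>R cis (a + s')" using qp by (simp add: s'_def \<nu>_def algebra_simps)
  ultimately show thesis using that \<rho> by blast
qed

section \<open>Cheeger regularity\<close>

lemma dots_polar:
  assumes k: "k \<ge> 1" and d: "dots k \<Omega> p x"
  obtains a where "\<And>i. i \<le> k \<Longrightarrow> x (Suc i) = p + circumradius \<Omega> *\<^sub>R cis (a + 2 * pi * real i / real k)"
proof -
  define a where "a = Arg (x 1 - p)"
  have R: "norm (x 1 - p) = circumradius \<Omega>"
    using d k by (auto simp: dots_def dist_norm)
  have "x (Suc i) = p + circumradius \<Omega> *\<^sub>R cis (a + 2 * pi * real i / real k)" if "i \<le> k" for i
    using that
  proof (induction i)
    case 0
    have "x 1 - p = norm (x 1 - p) *\<^sub>R cis a" unfolding a_def by (rule polar_form)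
    then show ?case unfolding R by (simp add: algebra_simps)
  next
    case (Suc i)
    have "x (Suc (Suc i)) = rotation k p (x (Suc i))" using d Suc.prems by (simp add: dots_def)
    moreover have ang: "a + 2 * pi * real (Suc i) / real k = 2 * pi / real k + (a + 2 * pi * real i / real k)"
      using k by (simp add: field_simps)
    ultimately show ?case unfolding ang using Suc by (simp add: rotation_def cis_mult)
  qed
  then show thesis by (rule that)
qed

text \<open>The sectors \<open>[a + 2\<pi>l/k, a + 2\<pi>(l + 1)/k]\<close> for \<open>l < k\<close> cover all directions.\<close>

lemma sector_index:
  fixes k :: nat
  assumes k: "k \<ge> 1"
  obtains l s where "l < k" "0 \<le> s" "s \<le> 2 * pi / real k" "cis w = cis (a + 2 * pi * real l / real k + s)"
proof -
  define y where "y = frac ((w - a) / (2 * pi)) * real k"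
  define l where "l = nat \<lfloor>y\<rfloor>"
  define s where "s = (y - real l) * (2 * pi / real k)"
  have y: "0 \<le> y" "y < real k"
    using k frac_lt_1[of "(w - a) / (2 * pi)"] by (auto simp: y_def frac_ge_0)
  have l: "real l \<le> y" "y < real l + 1" using y by (auto simp: l_def)
  have "l < k" using l y by linarith
  moreover have "0 \<le> s" using l by (simp add: s_def)
  moreover have "s \<le> 1 * (2 * pi / real k)" unfolding s_def using l by (intro mult_right_mono) auto
  moreover have "cis w = cis (a + 2 * pi * real l / real k + s)"
  proof -
    have "a + 2 * pi * real l / real k + s = a + 2 * pi * (y / real k)"
      using k by (simp add: s_def field_simps)
    also have "y / real k = frac ((w - a) / (2 * pi))" using k by (simp add: y_def)
    also have "a + 2 * pi * \<dots> = w + 2 * pi * real_of_int (- \<lfloor>(w - a) / (2 * pi)\<rfloor>)"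
      by (simp add: frac_def field_simps)
    finally have "cis (a + 2 * pi * real l / real k + s) = cis w * cis (2 * pi * real_of_int (- \<lfloor>(w - a) / (2 * pi)\<rfloor>))"
      unfolding cis_mult by simp
    also have "cis (2 * pi * real_of_int (- \<lfloor>(w - a) / (2 * pi)\<rfloor>)) = 1" by (rule cis_multiple_2pi) simp
    finally show ?thesis by simp
  qed
  ultimately show thesis using that by simp
qed

lemma average_at_maximum:
  fixes f :: "nat \<Rightarrow> real"
  assumes "\<And>j. j \<le> m \<Longrightarrow> f j \<le> H" "(1 / real (Suc m)) * (\<Sum>j\<le>m. f j) = H" "j \<le> m"
  shows "f j = H"
proof -
  have "(\<Sum>j\<le>m. H - f j) = 0" using assms(2) by (simp add: sum_subtractf field_simps)
  then have "\<forall>j\<in>{..m}. H - f j = 0" using assms(1) by (subst (asm) sum_nonneg_eq_0_iff) auto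
  then show ?thesis using assms(3) by auto
qed

text \<open>Strict convexity of the ball: a point of the sphere is an average of points of the ball only trivially. This
  settles the case in which the contact point is as far from \<open>p\<close> as a dot, where it may belong to two edges.\<close>

lemma average_in_sphere:
  fixes c :: "nat \<Rightarrow> 'a::real_inner"
  assumes c: "\<And>j. j \<le> m \<Longrightarrow> norm (c j - p) \<le> R"
    and z: "z = (1 / real (Suc m)) *\<^sub>R (\<Sum>j\<le>m. c j)" "norm (z - p) = R" and j: "j \<le> m"
  shows "c j = z"
proof -
  have R2: "(z - p) \<bullet> (z - p) = R\<^sup>2" using z(2) by (simp flip: power2_norm_eq_inner)
  have R0: "0 \<le> R" using z(2) norm_ge_zero by metis
  have zp: "z - p = (1 / real (Suc m)) *\<^sub>R (\<Sum>j\<le>m. c j - p)"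
    unfolding z(1) by (simp add: sum_subtractf scaleR_diff_right sum_constant_scaleR)
  have "(c j - p) \<bullet> (z - p) = R\<^sup>2"
  proof (rule average_at_maximum[where f = "\<lambda>j. (c j - p) \<bullet> (z - p)", OF _ _ j])
    fix j assume "j \<le> m"
    have "(c j - p) \<bullet> (z - p) \<le> norm (c j - p) * norm (z - p)" by (rule norm_cauchy_schwarz)
    also have "\<dots> \<le> R * R" using c[OF \<open>j \<le> m\<close>] z(2) R0 by (intro mult_mono) auto
    finally show "(c j - p) \<bullet> (z - p) \<le> R\<^sup>2" by (simp add: power2_eq_square)
  next
    have "(1 / real (Suc m)) * (\<Sum>j\<le>m. (c j - p) \<bullet> (z - p)) = ((1 / real (Suc m)) *\<^sub>R (\<Sum>j\<le>m. c j - p)) \<bullet> (z - p)"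
      by (simp add: inner_sum_left)
    then show "(1 / real (Suc m)) * (\<Sum>j\<le>m. (c j - p) \<bullet> (z - p)) = R\<^sup>2" using zp R2 by simp
  qed
  moreover have "(norm (c j - p))\<^sup>2 \<le> R\<^sup>2" using c[OF j] by (intro power_mono) auto
  moreover have "(norm ((c j - p) - (z - p)))\<^sup>2 = (norm (c j - p))\<^sup>2 - 2 * ((c j - p) \<bullet> (z - p)) + (norm (z - p))\<^sup>2"
    by (simp add: power2_norm_eq_inner inner_diff_left inner_diff_right inner_commute)
  ultimately have "(norm (c j - z))\<^sup>2 \<le> 0" using z(2) by simp
  then show ?thesis by simp
qed

theorem theorem3p1:
  fixes k :: nat and \<Omega> :: "complex set"
  assumes "k \<ge> 2"
    and "planar_convex_body \<Omega>"
    and "rotationally_symmetric k \<Omega>"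
  shows "cheeger_regular k \<Omega>"
  unfolding cheeger_regular_def
proof (intro allI impI ballI)
  fix p x C i
  assume sym: "symmetry_center k \<Omega> p" and dots: "dots k \<Omega> p x" and C: "is_closed_cheeger_set \<Omega> C"
    and i: "i \<in> {1..k}"
  note k = assms(1) and \<Omega> = assms(2)
  have k0: "k > 0" using k by simp
  have cpt\<Omega>: "compact \<Omega>" "convex \<Omega>" "closed \<Omega>" using \<Omega> by (auto simp: planar_convex_body_def compact_imp_closed)
  have p: "p \<in> interior \<Omega>" by (rule center_in_interior[OF k \<Omega> sym])
  define R where "R = circumradius \<Omega>"
  have ball: "\<Omega> \<subseteq> cball p R" unfolding R_def by (rule subset_cball_circumradius[OF k \<Omega> sym])
  have Csub: "C \<subseteq> \<Omega>" and Cpos: "0 < area C" and Cch: "is_cheeger_set \<Omega> C" and Cconv: "convex C" "closed C"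
    using C by (auto simp: is_closed_cheeger_set_def is_cheeger_set_def)
  have Ccpt: "compact C" using cpt\<Omega> Csub Cconv by (metis compact_Int_closed inf.absorb2)
  have Cint: "interior C \<noteq> {}"
  proof
    assume "interior C = {}"
    then have "negligible C" using negligible_convex_interior[OF Cconv(1)] by simp
    then have "emeasure lebesgue C = 0" by (simp only: negligible_iff_null_sets null_setsD1)
    then show False using Cpos by (simp add: area_def)
  qed
  obtain c where c: "0 < c" "area C = ennreal c"
    using area_finite[OF Ccpt] Cpos by (metis ennreal_cases ennreal_less_zero_iff less_irrefl)
  define A where "A j = root_rot k p j ` C" for j
  have A_eq: "A j = (\<lambda>z. (p - cis (2 * pi * real j / real k) * p) + cis (2 * pi * real j / real k) * z) ` C" for j
    unfolding A_def root_rot_def by (intro image_cong) (auto simp: algebra_simps)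
  have A: "compact (A j)" "convex (A j)" "interior (A j) \<noteq> {}" "perimeter (A j) \<le> perimeter C" "area (A j) = area C" for j
  proof -
    show "compact (A j)" unfolding A_eq by (intro compact_continuous_image Ccpt continuous_intros)
    have "convex ((*) (cis (2 * pi * real j / real k)) ` C)"
      by (intro convex_linear_image Cconv) (simp add: linear_times)
    moreover have "A j = (+) (p - cis (2 * pi * real j / real k) * p) ` ((*) (cis (2 * pi * real j / real k)) ` C)"
      unfolding A_eq image_image by (rule refl)
    ultimately show cv: "convex (A j)" by (simp only: convex_translation)
    show "perimeter (A j) \<le> perimeter C"
      unfolding A_eq using perimeter_similarity_le[OF Ccpt, of "cis (2 * pi * real j / real k)"] by simp
    show ar: "area (A j) = area C" unfolding A_eq by (intro area_rotate Ccpt) simp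
    show "interior (A j) \<noteq> {}"
    proof
      assume "interior (A j) = {}"
      then have "negligible (A j)" using negligible_convex_interior[OF cv] by simp
      then have "emeasure lebesgue (A j) = 0" by (simp only: negligible_iff_null_sets null_setsD1)
      then show False using Cpos ar by (simp add: area_def)
    qed
  qed
  have Asub: "A j \<subseteq> \<Omega>" for j
    unfolding A_def using Csub root_rot_image[OF k0 sym, of j] by blast
  define M where "M = minkowski_average A (k - 1)"
  have M: "compact M" "perimeter M \<le> perimeter C" "ennreal c \<le> area M"
    unfolding M_def using minkowski_average_convex_body[of A "perimeter C" c "k - 1"] A c by auto
  have "M \<subseteq> \<Omega>" unfolding M_def using cpt\<Omega> Asub by (intro minkowski_average_subset)
  then obtain m where m: "m \<in> M" "m \<in> frontier \<Omega>"
    using optimal_body_meets_frontier[OF cpt\<Omega>(1) Ccpt Cconv(1) Cint Cch M(1)] M c by auto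
  obtain q where q: "\<And>j. j \<le> k - 1 \<Longrightarrow> q j \<in> A j" "m = (1 / real (Suc (k - 1))) *\<^sub>R (\<Sum>j\<le>k - 1. q j)"
    using minkowski_averageE[OF m(1)[unfolded M_def]] by metis
  \<comment> \<open>A point on a supporting line that is an average of points of \<open>\<Omega>\<close> forces all of them onto that line.\<close>
  obtain n where n: "\<And>x. x \<in> \<Omega> \<Longrightarrow> x \<bullet> n \<le> m \<bullet> n" "p \<bullet> n < m \<bullet> n"
    using frontier_support_vector[OF cpt\<Omega>(3,2) _ m(2)] p by (metis empty_iff)
  have q\<Omega>: "q j \<in> \<Omega>" if "j \<le> k - 1" for j using q(1)[OF that] Asub by blast
  have qn: "q j \<bullet> n = m \<bullet> n" if "j \<le> k - 1" for j
  proof (rule average_at_maximum[where f = "\<lambda>j. q j \<bullet> n", OF _ _ that])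
    show "q j \<bullet> n \<le> m \<bullet> n" if "j \<le> k - 1" for j using n q\<Omega> that by blast
    show "1 / real (Suc (k - 1)) * (\<Sum>j\<le>k - 1. q j \<bullet> n) = m \<bullet> n"
      by (subst q(2)) (simp add: inner_sum_left)
  qed
  obtain a where xp: "\<And>i. i \<le> k \<Longrightarrow> x (Suc i) = p + R *\<^sub>R cis (a + 2 * pi * real i / real k)"
    using dots_polar[OF _ dots] k unfolding R_def by (metis Suc_1 Suc_leD)
  define b where "b = 2 * pi / real k"
  have b: "0 \<le> b" "b \<le> 2 * pi" using k by (auto simp: b_def field_simps)
  have x_fr: "p + R *\<^sub>R cis (a + 2 * pi * real l / real k) \<in> frontier \<Omega>" if "l \<le> k" for l
  proof (cases "l < k")
    case True
    then have "x (Suc l) \<in> frontier \<Omega>" using dots by (simp add: dots_def)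
    then show ?thesis using xp[OF that] by simp
  next
    case False
    then have "x (Suc l) = x 1" using that dots by (simp add: dots_def)
    moreover have "x 1 \<in> frontier \<Omega>" using dots k by (simp add: dots_def)
    ultimately show ?thesis using xp[OF that] by simp
  qed
  have fr\<Omega>: "z \<in> \<Omega>" if "z \<in> frontier \<Omega>" for z using that cpt\<Omega>(3) by (simp add: frontier_def)
  have R0: "0 \<le> R" using ball p interior_subset by fastforce
  \<comment> \<open>Polar coordinates of \<open>m\<close> and the sector of consecutive dots containing it.\<close>
  obtain l s where ls: "l < k" "0 \<le> s" "s \<le> b" "cis (Arg (m - p)) = cis (a + 2 * pi * real l / real k + s)"
    using sector_index[of k "Arg (m - p)" a] k unfolding b_def by auto
  define r where "r = norm (m - p)"
  have mp: "m = p + r *\<^sub>R cis (a + 2 * pi * real l / real k + s)"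
  proof -
    have "m - p = norm (m - p) *\<^sub>R cis (Arg (m - p))" by (rule polar_form)
    then show ?thesis unfolding ls r_def by (simp add: algebra_simps)
  qed
  have next_angle: "a + 2 * pi * real l / real k + b = a + 2 * pi * real (Suc l) / real k" for l
    using k by (simp add: b_def field_simps)
  have sector: "\<exists>r' s'. 0 \<le> r' \<and> 0 \<le> s' \<and> s' \<le> b \<and> q j = p + r' *\<^sub>R cis (a + 2 * pi * real l / real k + s')"
    if j: "j \<le> k - 1" for j
  proof (cases "r < R")
    case True
    have u: "p + R *\<^sub>R cis (a + 2 * pi * real l / real k) \<in> \<Omega>"
      "p + R *\<^sub>R cis (a + 2 * pi * real l / real k + b) \<in> \<Omega>"
      unfolding next_angle using fr\<Omega>[OF x_fr[of l]] fr\<Omega>[OF x_fr[of "Suc l"]] ls(1) by simp_all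
    have r0: "0 \<le> r" by (simp add: r_def)
    show ?thesis
      using face_in_sector[OF ball u mp r0 True ls(2,3) q\<Omega>[OF j] qn[OF j] n] by metis
  next
    case False
    have mR: "norm (m - p) = R"
      using False ball fr\<Omega>[OF m(2)] by (auto simp: r_def dist_norm norm_minus_commute)
    have "norm (q j - p) \<le> R" if "j \<le> k - 1" for j
      using subsetD[OF ball q\<Omega>[OF that]] by (simp add: dist_norm norm_minus_commute)
    then have "q j = m" using q(2) mR j by (rule average_in_sphere)
    then show ?thesis using mp ls by (metis norm_ge_zero r_def)
  qed
  \<comment> \<open>The rotation by \<open>j\<close> steps carries edge \<open>i\<close> onto the edge in the sector of \<open>m\<close>, so it is undone on \<open>q j\<close>.\<close>
  define l' where "l' = i - 1"
  have l': "i = Suc l'" "l' < k" using i by (auto simp: l'_def)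
  \<comment> \<open>The representative in \<open>{0..<k}\<close> of \<open>l - l'\<close> modulo \<open>k\<close>.\<close>
  define j where "j = (if l' \<le> l then l - l' else l + k - l')"
  have j: "j \<le> k - 1" using ls l' by (auto simp: j_def)
  obtain r' s' where rs: "0 \<le> r'" "0 \<le> s'" "s' \<le> b" "q j = p + r' *\<^sub>R cis (a + 2 * pi * real l / real k + s')"
    using sector[OF j] by blast
  obtain z where z: "z \<in> C" "q j = root_rot k p j z" using q(1)[OF j] by (auto simp: A_def)
  have zp: "z = p + r' *\<^sub>R cis (a + 2 * pi * real l' / real k + s')"
  proof -
    have ang: "cis (a + 2 * pi * real l / real k + s') = cis (2 * pi * real j / real k) * cis (a + 2 * pi * real l' / real k + s')"
    proof (cases "l' \<le> l")
      case True
      then have "a + 2 * pi * real l / real k + s' = 2 * pi * real j / real k + (a + 2 * pi * real l' / real k + s')"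
        using k by (simp add: j_def field_simps of_nat_diff)
      then show ?thesis by (simp only: cis_mult)
    next
      case False
      then have "2 * pi * real j / real k + (a + 2 * pi * real l' / real k + s') = (a + 2 * pi * real l / real k + s') + 2 * pi"
        using k l' by (simp add: j_def field_simps of_nat_diff)
      then have "cis (2 * pi * real j / real k) * cis (a + 2 * pi * real l' / real k + s')
          = cis (a + 2 * pi * real l / real k + s') * cis (2 * pi)" by (simp only: cis_mult)
      then show ?thesis by simp
    qed
    have "cis (2 * pi * real j / real k) * (z - p) = cis (2 * pi * real j / real k) * (r' *\<^sub>R cis (a + 2 * pi * real l' / real k + s'))"
      using z(2) rs(4) unfolding ang by (simp add: root_rot_def)
    then have "z - p = r' *\<^sub>R cis (a + 2 * pi * real l' / real k + s')"
      by (simp only: mult_cancel_left cis_neq_zero simp_thms)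
    then show ?thesis by (metis add.commute diff_add_cancel)
  qed
  have z_fr: "z \<in> frontier \<Omega>"
  proof -
    have "n \<noteq> 0" using n(2) by auto
    then have "q j \<in> frontier \<Omega>" using n(1) qn[OF j] by (intro maximizer_in_frontier[OF q\<Omega>[OF j]]) auto
    then have "z \<notin> interior \<Omega>" using interior_root_rot[OF k0 sym, of z j] z(2) by (auto simp: frontier_def)
    then show ?thesis using z(1) Csub closure_subset by (auto simp: frontier_def)
  qed
  have "z \<in> ccw_arc \<Omega> (p + R *\<^sub>R cis (a + 2 * pi * real l' / real k)) (p + R *\<^sub>R cis (a + 2 * pi * real l' / real k + b))"
    unfolding zp
  proof (rule sector_in_ccw_arc[OF \<Omega> p])
    show "p + r' *\<^sub>R cis (a + 2 * pi * real l' / real k + s') \<in> frontier \<Omega>" using z_fr zp by simp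
    show "p + R *\<^sub>R cis (a + 2 * pi * real l' / real k) \<in> frontier \<Omega>"
      "p + R *\<^sub>R cis (a + 2 * pi * real l' / real k + b) \<in> frontier \<Omega>"
      unfolding next_angle using x_fr[of l'] x_fr[of "Suc l'"] l' by simp_all
  qed (use rs R0 b in auto)
  then have "z \<in> edge \<Omega> x i"
    unfolding edge_def l' next_angle using xp[of l'] xp[of "Suc l'"] l' by simp
  then show "C \<inter> edge \<Omega> x i \<noteq> {}" using z(1) by blast
qed

end
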